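(* Let $L\ge 2$, let $S,S'$ be dense countable subsets of $\mathbb{S}_L$ and let $p,p'\in(0,1)$. Let $G=G_{L,S,p}$ and $G'=G_{L,S',p'}$ be independent. Then, almost surely: (1) $G\not\cong G'$ if $L\notin\mathbb{Q}$; (2) $G\cong G'$ if $L\in\mathbb{Q}$ and $S$ and $S'$ are integer-distance-free.
   Context: $\mathbb{S}_L:=\mathbb{R}/L\mathbb{Z}$ is the circle of circumference $L$ with intrinsic metric $\|u-v\|=\min\{|u-v|,L-|u-v|\}$. For a dense countable $S\subset\mathbb{S}_L$ and $p\in(0,1)$, $G_{L,S,p}$ is the random graph with vertex set $S$ in which each pair $u,v\in S$ with $\|u-v\|<1$ is joined by an edge with probability $p$, independently over pairs, and pairs with $\|u-v\|\ge1$ are never joined. $\cong$ denotes graph isomorphism. For rational $L=\ell/m$ in lowest terms, a set $S\subset\mathbb{S}_L$ is integer-distance-free if no two distinct points of $S$ are at distance $\|u-v\|$ which is an integer multiple of $\frac1m$. *)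

theory Defs
  imports "HOL-Probability.Probability"
begin

text \<open>
  The circle \<open>\<real>/L\<int>\<close> is represented by its fundamental domain \<open>[0, L)\<close>, on which the intrinsic
  metric is \<open>min |u - v| (L - |u - v|)\<close>; \<open>circle_dist_eq_quotient_dist\<close> identifies it with the
  quotient metric.
\<close>

definition circle :: "real \<Rightarrow> real set" where
  "circle L = {0..<L}"

definition circle_dist :: "real \<Rightarrow> real \<Rightarrow> real \<Rightarrow> real" where
  "circle_dist L u v = min \<bar>u - v\<bar> (L - \<bar>u - v\<bar>)"

lemma circle_dist_eq_quotient_dist:
  assumes "u \<in> circle L" "v \<in> circle L"
  shows "circle_dist L u v = (INF k::int. \<bar>u - v + of_int k * L\<bar>)"
proof -
  have b: "\<bar>u - v\<bar> < L" "L > 0"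
    using assms by (auto simp: circle_def)
  have le: "circle_dist L u v \<le> \<bar>u - v + of_int k * L\<bar>" for k :: int
  proof (cases "k = 0")
    case False
    then have "1 \<le> \<bar>real_of_int k\<bar>"
      by linarith
    then have "L \<le> \<bar>of_int k * L\<bar>"
      using b by (simp add: abs_mult)
    then show ?thesis
      by (auto simp: circle_dist_def)
  qed (simp add: circle_dist_def)
  have ex: "\<exists>k::int. \<bar>u - v + of_int k * L\<bar> = circle_dist L u v"
  proof (cases "\<bar>u - v\<bar> \<le> L - \<bar>u - v\<bar>")
    case True
    then show ?thesis
      by (intro exI[of _ 0]) (simp add: circle_dist_def)
  next
    case False
    then show ?thesis
      using b by (intro exI[of _ "if u \<ge> v then - 1 else 1"]) (auto simp: circle_dist_def)
  qed
  then obtain k :: int where k: "\<bar>u - v + of_int k * L\<bar> = circle_dist L u v"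
    by blast
  show ?thesis
    by (rule cInf_eq_minimum[symmetric]) (use k[symmetric] le in auto)
qed

definition dense_in_circle :: "real \<Rightarrow> real set \<Rightarrow> bool" where
  "dense_in_circle L S \<longleftrightarrow>
     S \<subseteq> circle L \<and> (\<forall>x\<in>circle L. \<forall>\<epsilon>>0. \<exists>s\<in>S. circle_dist L x s < \<epsilon>)"

text \<open>For \<open>L \<ge> 0\<close> rational, \<open>l\<close> and \<open>m\<close> are uniquely determined.\<close>

definition integer_distance_free :: "real \<Rightarrow> real set \<Rightarrow> bool" where
  "integer_distance_free L S \<longleftrightarrow>
     (\<exists>l m :: nat. m > 0 \<and> coprime l m \<and> L = real l / real m \<and>
        (\<forall>u\<in>S. \<forall>v\<in>S. u \<noteq> v \<longrightarrow>
           \<not> (\<exists>k::int. circle_dist L u v = of_int k * (1 / real m))))"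

definition close_pairs :: "real \<Rightarrow> real set \<Rightarrow> real set set" where
  "close_pairs L S = {{u, v} | u v. u \<in> S \<and> v \<in> S \<and> u \<noteq> v \<and> circle_dist L u v < 1}"

text \<open>
  A random graph on the fixed vertex set \<open>S\<close> is given by its random edge set \<open>G \<omega>\<close>, a set of
  two-element subsets of \<open>S\<close>.
\<close>

definition random_geometric_graph ::
    "'a measure \<Rightarrow> real \<Rightarrow> real set \<Rightarrow> real \<Rightarrow> ('a \<Rightarrow> real set set) \<Rightarrow> bool" where
  "random_geometric_graph M L S p G \<longleftrightarrow>
     (\<forall>\<omega>\<in>space M. G \<omega> \<subseteq> close_pairs L S) \<and>
     (\<forall>e\<in>close_pairs L S. measure M {\<omega> \<in> space M. e \<in> G \<omega>} = p) \<and>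
     prob_space.indep_events M (\<lambda>e. {\<omega> \<in> space M. e \<in> G \<omega>}) (close_pairs L S)"

text \<open>The \<open>\<sigma>\<close>-algebra on edge sets with respect to which a random graph is a random variable.\<close>

definition edge_set_space :: "real \<Rightarrow> real set \<Rightarrow> real set set measure" where
  "edge_set_space L S =
     sigma (Pow (close_pairs L S))
       ((\<lambda>e. {E \<in> Pow (close_pairs L S). e \<in> E}) ` close_pairs L S)"

text \<open>Simple graphs are pairs of a vertex set and a set of two-element sets of vertices.\<close>

definition graph_iso :: "'v set \<times> 'v set set \<Rightarrow> 'w set \<times> 'w set set \<Rightarrow> bool"
    (infix "\<cong>\<^sub>G" 50) where
  "H \<cong>\<^sub>G H' \<longleftrightarrow>
     (\<exists>f. bij_betw f (fst H) (fst H') \<and>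
        (\<forall>u\<in>fst H. \<forall>v\<in>fst H. {u, v} \<in> snd H \<longleftrightarrow> {f u, f v} \<in> snd H'))"

end

theory Submission
  imports Defs
begin

text \<open>
  Almost surely both graphs are saturated: every adjacency pattern towards finitely many vertices
  is realised inside every arc on which closeness allows it.

  For \<open>L = l / m\<close>, cut the circle into \<open>l\<close> arcs of length \<open>1 / m\<close>. Whether two points are at
  distance less than \<open>1\<close> depends only on their arcs and on the order of their offsets inside the
  arcs, and these offsets are distinct for integer-distance-free sets. Saturation therefore allows a
  back-and-forth construction that preserves arcs, the order of offsets, and adjacency.

  For \<open>L\<close> irrational, \<open>d(z, v) \<le> 1\<close> holds iff \<open>A \<union> {z}\<close> has a common neighbour for every
  finite set \<open>A\<close> of neighbours of \<open>v\<close>. So an isomorphism preserves the relation \<open>d \<le> 1\<close>, extends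
  to a continuous self-map \<open>g\<close> of the circle that preserves distance \<open>1\<close>, and by connectedness
  satisfies \<open>g (x + 1) = g x + 1\<close> throughout or \<open>g (x + 1) = g x - 1\<close> throughout. Density of the
  orbits of the rotation by \<open>1\<close> makes \<open>g\<close> a rotation or a reflection. Only countably many of
  these map a given point of \<open>S\<close> into \<open>S'\<close>, and each is an isomorphism with probability \<open>0\<close>.
\<close>

section \<open>Independent events\<close>

lemma (in prob_space) indep_sets_sigma_sets_singleton:
  assumes "indep_events A I"
  shows "indep_sets (\<lambda>i. sigma_sets (space M) {A i}) I"
  using assms unfolding indep_events_def_alt by (rule indep_sets_sigma) (simp add: Int_stable_def)

text \<open>Independence passes to the sigma-algebras generated by the single events, and these
  contain the complements, so each factor may be \<open>A j\<close> or its complement.\<close>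

lemma (in prob_space) prob_indep_events_pattern:
  assumes ind: "indep_events A I" and p: "\<And>i. i \<in> I \<Longrightarrow> prob (A i) = p"
    and J: "J \<subseteq> I" "finite J"
  shows "prob {\<omega> \<in> space M. \<forall>j\<in>J. \<omega> \<in> A j \<longleftrightarrow> j \<in> K} = (\<Prod>j\<in>J. if j \<in> K then p else 1 - p)"
\<comment> \<open>The product rule needs a nonempty index set; an empty intersection would be
  everything rather than \<open>space M\<close>.\<close>
proof (cases "J = {}")
  case True
  then show ?thesis by (simp add: prob_space)
next
  case False
  have ev: "A i \<in> events" if "i \<in> I" for i
    using ind that by (auto simp: indep_events_def)
  let ?B = "\<lambda>j. if j \<in> K then A j else space M - A j"
  have "prob (\<Inter>j\<in>J. ?B j) = (\<Prod>j\<in>J. prob (?B j))"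
  proof (rule indep_setsD[OF indep_sets_sigma_sets_singleton[OF ind] J(1) False J(2)], safe)
    fix j
    show "?B j \<in> sigma_sets (space M) {A j}"
      by (auto intro: sigma_sets.intros)
  qed
  also have "\<dots> = (\<Prod>j\<in>J. if j \<in> K then p else 1 - p)"
    using J ev p by (intro prod.cong) (auto simp: prob_compl)
  also have "(\<Inter>j\<in>J. ?B j) = {\<omega> \<in> space M. \<forall>j\<in>J. \<omega> \<in> A j \<longleftrightarrow> j \<in> K}"
  proof (intro equalityI subsetI)
    fix \<omega> assume \<omega>: "\<omega> \<in> (\<Inter>j\<in>J. ?B j)"
    obtain j where "j \<in> J" using False by blast
    then have "\<omega> \<in> ?B j" "A j \<subseteq> space M"
      using \<omega> J ev[THEN sets.sets_into_space, of j] by blast+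
    then have "\<omega> \<in> space M"
      by (auto split: if_splits)
    then show "\<omega> \<in> {\<omega> \<in> space M. \<forall>j\<in>J. \<omega> \<in> A j \<longleftrightarrow> j \<in> K}"
      using \<omega> by (auto split: if_splits)
  qed auto
  finally show ?thesis .
qed

text \<open>The blocks \<open>J s\<close> are disjoint, so the pattern events are independent.
  Bounded block size bounds their probabilities away from 0, so infinitely many of them almost
  surely do not all fail.\<close>

lemma (in prob_space) AE_ex_indep_events_pattern:
  assumes ind: "indep_events A I" and p: "\<And>i. i \<in> I \<Longrightarrow> prob (A i) = p" "0 < p" "p < 1"
    and T: "infinite T" and J: "disjoint_family_on J T"
      "\<And>s. s \<in> T \<Longrightarrow> J s \<subseteq> I \<and> finite (J s) \<and> card (J s) \<le> N"
  shows "AE \<omega> in M. \<exists>s\<in>T. \<forall>j\<in>J s. \<omega> \<in> A j \<longleftrightarrow> j \<in> K s"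
proof -
  have ev: "A i \<in> events" if "i \<in> I" for i
    using ind that by (auto simp: indep_events_def)
  define W where "W s = {\<omega> \<in> space M. \<forall>j\<in>J s. \<omega> \<in> A j \<longleftrightarrow> j \<in> K s}" for s
  \<comment> \<open>A block of at most \<open>N\<close> events shows any given pattern with at least
    this probability.\<close>
  define q where "q = min p (1 - p) ^ N"
  have q: "0 < q" "q < 1 \<or> N = 0" "q \<le> 1"
    using p by (auto simp: q_def min_def power_less_one_iff power_le_one)
  have Wsig: "W s \<in> sigma_sets (space M) (\<Union>i\<in>J s. sigma_sets (space M) {A i})" if "s \<in> T" for s
  proof -
    let ?\<Sigma> = "sigma_sets (space M) (\<Union>i\<in>J s. sigma_sets (space M) {A i})"
    have *: "(\<Union>i\<in>J s. sigma_sets (space M) {A i}) \<subseteq> Pow (space M)"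
    proof safe
      fix i B x assume "i \<in> J s" "B \<in> sigma_sets (space M) {A i}" "x \<in> B"
      moreover have "{A i} \<subseteq> Pow (space M)"
        using J(2)[OF that] \<open>i \<in> J s\<close> ev[THEN sets.sets_into_space] by auto
      ultimately show "x \<in> space M"
        using sigma_sets_into_sp[of "{A i}" "space M" B] by (auto simp: subset_iff)
    qed
    interpret \<Sigma>: sigma_algebra "space M" ?\<Sigma>
      using * by (rule sigma_algebra_sigma_sets)
    have "{\<omega> \<in> space M. \<omega> \<in> A j} \<in> ?\<Sigma>" if "j \<in> J s" for j
    proof -
      have "{\<omega> \<in> space M. \<omega> \<in> A j} = A j"
        using ev[THEN sets.sets_into_space] J(2)[OF \<open>s \<in> T\<close>] that by auto
      then show ?thesis using that by (auto intro!: sigma_sets.Basic)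
    qed
    then have "{\<omega> \<in> space M. \<omega> \<in> A j \<longleftrightarrow> j \<in> K s} \<in> ?\<Sigma>" if "j \<in> J s" for j
      using that \<Sigma>.sets_Collect_neg[of "\<lambda>\<omega>. \<omega> \<in> A j"] by (cases "j \<in> K s") simp_all
    then show ?thesis
      unfolding W_def using J(2)[OF that] by (intro \<Sigma>.sets_Collect_finite_All) auto
  qed
  \<comment> \<open>Grouping independent sigma-algebras into disjoint blocks keeps independence;
    \<open>Wsig\<close> puts each pattern event into the sigma-algebra of its own block.\<close>
  have ind2: "indep_sets (\<lambda>s. sigma_sets (space M) (\<Union>i\<in>J s. sigma_sets (space M) {A i})) T"
  proof (rule indep_sets_collect_sigma[OF _ _ J(1)])
    show "indep_sets (\<lambda>i. sigma_sets (space M) {A i}) (\<Union> (J ` T))"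
      using J(2) by (intro indep_sets_mono_index[OF _ indep_sets_sigma_sets_singleton[OF ind]]) auto
    fix i s assume "s \<in> T" "i \<in> J s"
    then have "{A i} \<subseteq> Pow (space M)"
      using J(2) ev[THEN sets.sets_into_space] by auto
    then interpret sigma_algebra "space M" "sigma_sets (space M) {A i}"
      by (rule sigma_algebra_sigma_sets)
    show "Int_stable (sigma_sets (space M) {A i})"
      by (auto simp: Int_stable_def)
  qed
  have Wev: "W s \<in> events" if "s \<in> T" for s
    using ind2 Wsig[OF that] that by (auto simp: indep_sets_def)
  have Wge: "prob (W s) \<ge> q" if "s \<in> T" for s
  proof -
    have "q \<le> min p (1 - p) ^ card (J s)"
      unfolding q_def using p J(2)[OF that] by (intro power_decreasing) auto
    also have "\<dots> \<le> (\<Prod>j\<in>J s. if j \<in> K s then p else 1 - p)"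
      using p by (subst prod_constant[symmetric], intro prod_mono) auto
    also have "\<dots> = prob (W s)"
      unfolding W_def using J(2)[OF that] p by (subst prob_indep_events_pattern[OF ind]) auto
    finally show ?thesis .
  qed
  have fail: "prob (\<Inter>s\<in>F. space M - W s) \<le> (1 - q) ^ card F"
    if F: "F \<subseteq> T" "finite F" "F \<noteq> {}" for F
  proof -
    have "prob (\<Inter>s\<in>F. space M - W s) = (\<Prod>s\<in>F. prob (space M - W s))"
      using Wsig F by (intro indep_setsD[OF ind2]) (auto intro: sigma_sets.intros)
    also have "\<dots> \<le> (\<Prod>s\<in>F. 1 - q)"
      using Wge Wev F by (intro prod_mono) (auto simp: prob_compl subset_eq)
    finally show ?thesis by simp
  qed
  \<comment> \<open>An injective sequence in \<open>T\<close> suffices: that all its pattern events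
    fail is a measurable event of probability at most \<open>(1 - q) ^ Suc n\<close> for every
    \<open>n\<close>.\<close>
  have N0: "\<exists>N0\<in>null_sets M. {\<omega>\<in>space M. \<not> (\<exists>s\<in>T. \<omega> \<in> W s)} \<subseteq> N0"
  proof -
    obtain t :: "nat \<Rightarrow> _" where t: "inj t" "range t \<subseteq> T"
      using infinite_countable_subset[OF T] by blast
    have Wt: "W (t n) \<in> events" for n using Wev t by blast
    let ?N = "\<Inter>n. space M - W (t n)"
    have Nev: "?N \<in> events" using Wt by (intro sets.countable_INT) auto
    have le: "prob ?N \<le> (1 - q) ^ Suc n" for n
    proof -
      have "prob ?N \<le> prob (\<Inter>s\<in>t ` {..n}. space M - W s)"
        using Wt by (intro finite_measure_mono sets.finite_INT) auto
      also have "\<dots> \<le> (1 - q) ^ card (t ` {..n})"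
        using t by (intro fail) auto
      also have "card (t ` {..n}) = Suc n"
        using t by (subst card_image) (auto intro: inj_on_subset)
      finally show ?thesis .
    qed
    have "(\<lambda>n. (1 - q) ^ Suc n) \<longlonglongrightarrow> 0"
      using q by (intro LIMSEQ_Suc LIMSEQ_power_zero) auto
    then have "prob ?N \<le> 0"
      using le by (intro LIMSEQ_le_const) auto
    then have "?N \<in> null_sets M"
      using Nev by (auto simp: emeasure_eq_measure null_sets_def measure_nonneg intro: antisym)
    moreover have "{\<omega>\<in>space M. \<not> (\<exists>s\<in>T. \<omega> \<in> W s)} \<subseteq> ?N" using t by auto
    ultimately show ?thesis by blast
  qed
  then show ?thesis
    by (elim bexE, intro AE_I'[of _ M]) (auto simp: W_def)
qed

section \<open>Saturation\<close>

lemma dense_in_circle_meets_open: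
  assumes S: "dense_in_circle L S" and U: "open U" "U \<inter> {0<..<L} \<noteq> {}"
  shows "S \<inter> U \<inter> {0<..<L} \<noteq> {}"
proof -
  obtain x where x: "x \<in> U" "0 < x" "x < L" using U by auto
  have "open (U \<inter> {0<..<L})" using U by auto
  then obtain r where r: "r > 0" "ball x r \<subseteq> U \<inter> {0<..<L}"
    using x by (meson IntI greaterThanLessThan_iff openE)
  \<comment> \<open>With \<epsilon> at most the distance from \<open>x\<close> to either end of the
    interval, wrapping around is ruled out, so \<open>circle_dist\<close> controls the ordinary
    distance.\<close>
  define \<epsilon> where "\<epsilon> = min r (min x (L - x))"
  have "\<epsilon> > 0" using r x by (auto simp: \<epsilon>_def)
  then obtain s where s: "s \<in> S" "circle_dist L x s < \<epsilon>"
    using S x unfolding dense_in_circle_def circle_def by (meson atLeastLessThan_iff less_imp_le)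
  moreover have "s \<in> circle L" using S s by (auto simp: dense_in_circle_def)
  ultimately have "\<bar>x - s\<bar> < r"
    by (auto simp: circle_dist_def circle_def \<epsilon>_def min_def split: if_splits)
  then have "s \<in> ball x r" by (simp add: dist_real_def)
  then show ?thesis using r s by blast
qed

text \<open>If only finitely many points were met, removing them from \<open>U\<close> would leave
  an open set that \<open>S\<close> misses.\<close>

lemma dense_in_circle_infinite:
  assumes S: "dense_in_circle L S" and U: "open U" "U \<inter> {0<..<L} \<noteq> {}"
  shows "infinite (S \<inter> U)"
proof
  assume fin: "finite (S \<inter> U)"
  have "open (U \<inter> {0<..<L})" using U by auto
  then have "infinite (U \<inter> {0<..<L})"
    using U finite_imp_not_open by blast
  then have "U \<inter> {0<..<L} - S \<inter> U \<noteq> {}"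
    using fin by (metis finite_subset Diff_eq_empty_iff)
  then have "(U - S \<inter> U) \<inter> {0<..<L} \<noteq> {}" by blast
  moreover have "open (U - S \<inter> U)" using fin U by (simp add: open_Diff finite_imp_closed)
  ultimately show False
    using dense_in_circle_meets_open[OF S] by blast
qed

text \<open>A localised form of the extension property of the Rado graph: \<open>A\<close> lists
  required neighbours, \<open>B\<close> required non-neighbours. Closeness is demanded throughout
  \<open>U\<close> because only close pairs are random.\<close>

definition saturated :: "real \<Rightarrow> real set \<Rightarrow> real set set \<Rightarrow> bool" where
  "saturated L S E \<longleftrightarrow>
     (\<forall>U A B. open U \<and> U \<inter> {0<..<L} \<noteq> {} \<and> finite A \<and> finite B \<and> A \<subseteq> S \<and> B \<subseteq> S \<and> A \<inter> B = {} \<and>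
        (\<forall>x\<in>U \<inter> circle L. \<forall>w\<in>A \<union> B. circle_dist L x w < 1) \<longrightarrow>
        (\<exists>s\<in>S \<inter> U. s \<notin> A \<union> B \<and> (\<forall>w\<in>A. {s, w} \<in> E) \<and> (\<forall>w\<in>B. {s, w} \<notin> E)))"

lemma saturatedD:
  assumes "saturated L S E" "open U" "U \<inter> {0<..<L} \<noteq> {}" "finite A" "finite B" "A \<subseteq> S" "B \<subseteq> S"
    "A \<inter> B = {}" "\<And>x w. x \<in> U \<inter> circle L \<Longrightarrow> w \<in> A \<union> B \<Longrightarrow> circle_dist L x w < 1"
  shows "\<exists>s\<in>S \<inter> U. s \<notin> A \<union> B \<and> (\<forall>w\<in>A. {s, w} \<in> E) \<and> (\<forall>w\<in>B. {s, w} \<notin> E)"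
  using assms(1)[unfolded saturated_def, rule_format, of U A B] assms(2-) by blast

text \<open>Intervals with rational endpoints and finite \<open>A\<close>, \<open>B\<close> give
  countably many cases; in each one, the infinitely many candidates in the interval are independent
  trials.\<close>

lemma (in prob_space) AE_saturated:
  assumes G: "random_geometric_graph M L S p G" and p: "0 < p" "p < 1"
    and S: "countable S" "dense_in_circle L S"
  shows "AE \<omega> in M. saturated L S (G \<omega>)"
proof -
  define E where "E e = {\<omega> \<in> space M. e \<in> G \<omega>}" for e
  have ind: "indep_events E (close_pairs L S)"
    and prob: "\<And>e. e \<in> close_pairs L S \<Longrightarrow> prob (E e) = p"
    using G by (auto simp: random_geometric_graph_def E_def[abs_def])
  define Q where "Q a b A B \<longleftrightarrow> 0 \<le> a \<and> a < b \<and> b \<le> L \<and> A \<inter> B = {} \<and>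
        (\<forall>x\<in>{a<..<b}. \<forall>w\<in>A \<union> B. circle_dist L x w < 1)" for a b A B
  define R where "R E' a b A B \<longleftrightarrow>
        (\<exists>s\<in>S \<inter> {a<..<b}. s \<notin> A \<union> B \<and> (\<forall>w\<in>A. {s, w} \<in> E') \<and> (\<forall>w\<in>B. {s, w} \<notin> E'))" for E' a b A B
  have *: "AE \<omega> in M. Q a b A B \<longrightarrow> R (G \<omega>) a b A B"
    if AB: "finite A" "finite B" "A \<subseteq> S" "B \<subseteq> S" for a b A B
  proof (cases "Q a b A B")
    case True
    \<comment> \<open>Leaving out \<open>A \<union> B\<close> makes every \<open>{s, w}\<close> a
      genuine pair and the sets of pairs at different \<open>s\<close> disjoint.\<close>
    define T where "T = S \<inter> {a<..<b} - (A \<union> B)"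
    have T: "infinite T"
      unfolding T_def using AB True
      by (intro Diff_infinite_finite dense_in_circle_infinite[OF S(2)])
         (auto simp: Q_def Int_greaterThanLessThan max_def min_def)
    have "AE \<omega> in M. \<exists>s\<in>T. \<forall>e\<in>(\<lambda>w. {s, w}) ` (A \<union> B). \<omega> \<in> E e \<longleftrightarrow> e \<in> (\<lambda>w. {s, w}) ` A"
    proof (rule AE_ex_indep_events_pattern[OF ind prob p T])
      show "disjoint_family_on (\<lambda>s. (\<lambda>w. {s, w}) ` (A \<union> B)) T"
        unfolding disjoint_family_on_def T_def by (auto simp: doubleton_eq_iff)
      fix s assume s: "s \<in> T"
      have "(\<lambda>w. {s, w}) ` (A \<union> B) \<subseteq> close_pairs L S"
      proof
        fix e assume "e \<in> (\<lambda>w. {s, w}) ` (A \<union> B)"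
        then obtain w where w: "w \<in> A \<union> B" "e = {s, w}" by blast
        have "circle_dist L s w < 1" using s w True by (auto simp: T_def Q_def)
        then show "e \<in> close_pairs L S"
          unfolding close_pairs_def using w s AB by (auto simp: T_def)
      qed
      then show "(\<lambda>w. {s, w}) ` (A \<union> B) \<subseteq> close_pairs L S \<and> finite ((\<lambda>w. {s, w}) ` (A \<union> B)) \<and>
          card ((\<lambda>w. {s, w}) ` (A \<union> B)) \<le> card (A \<union> B)"
        using AB by (simp add: card_image_le)
    qed
    then show ?thesis
      using AE_space
    proof eventually_elim
      case (elim \<omega>)
      then obtain s where s: "s \<in> T"
        "\<And>w. w \<in> A \<union> B \<Longrightarrow> \<omega> \<in> E {s, w} \<longleftrightarrow> {s, w} \<in> (\<lambda>w. {s, w}) ` A" by blast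
      have "\<omega> \<in> E {s, w} \<longleftrightarrow> w \<in> A" if "w \<in> A \<union> B" for w
        using s(2)[OF that] by (auto simp: doubleton_eq_iff)
      then have "{s, w} \<in> G \<omega> \<longleftrightarrow> w \<in> A" if "w \<in> A \<union> B" for w
        using that elim(2) by (simp add: E_def)
      then have "R (G \<omega>) a b A B"
        using s(1) True unfolding R_def Q_def T_def by (intro bexI[of _ s]) auto
      then show ?case by simp
    qed
  qed simp
  have "AE \<omega> in M. \<forall>(A, B, a, b)\<in>{A. finite A \<and> A \<subseteq> S} \<times> {B. finite B \<and> B \<subseteq> S} \<times> \<rat> \<times> \<rat>.
           Q a b A B \<longrightarrow> R (G \<omega>) a b A B"
    using * S(1) by (subst AE_ball_countable)
      (auto intro!: countable_SIGMA countable_Collect_finite_subset countable_rat)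
  then show ?thesis
  proof eventually_elim
    case (elim \<omega>)
    show ?case
      unfolding saturated_def
    proof (intro allI impI, elim conjE)
      fix U A B assume U: "open U" "U \<inter> {0<..<L} \<noteq> {}" and AB: "finite A" "finite B" "A \<subseteq> S" "B \<subseteq> S" "A \<inter> B = {}"
        and close: "\<forall>x\<in>U \<inter> circle L. \<forall>w\<in>A \<union> B. circle_dist L x w < 1"
      obtain x where x: "x \<in> U" "0 < x" "x < L" using U by auto
      have "open (U \<inter> {0<..<L})" using U by auto
      then obtain r where r: "r > 0" "ball x r \<subseteq> U \<inter> {0<..<L}"
        using x by (meson IntI greaterThanLessThan_iff openE)
      obtain a where a: "a \<in> \<rat>" "x - r < a" "a < x" using Rats_dense_in_real[of "x - r" x] r by auto
      obtain b where b: "b \<in> \<rat>" "x < b" "b < x + r" using Rats_dense_in_real[of x "x + r"] r by auto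
      have ab: "{a<..<b} \<subseteq> U \<inter> {0<..<L}"
        using r(2) a b by (auto simp: ball_eq_greaterThanLessThan subset_eq)
      have "0 \<le> a \<and> b \<le> L"
        using ab a(3) b(2) x(2,3) by (metis Int_iff greaterThanLessThan_iff in_mono less_irrefl
            less_trans not_le)
      then have "Q a b A B" using AB close ab a b
        by (auto simp: Q_def circle_def subset_eq)
      then have "R (G \<omega>) a b A B"
        using elim a b AB by auto
      then show "\<exists>s\<in>S \<inter> U. s \<notin> A \<union> B \<and> (\<forall>w\<in>A. {s, w} \<in> G \<omega>) \<and> (\<forall>w\<in>B. {s, w} \<notin> G \<omega>)"
        unfolding R_def using ab by blast
    qed
  qed
qed

section \<open>Rational circumference\<close>

text \<open>\<open>Q\<close> expresses compatibility of two matched pairs. Finite compatible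
  relations are enlarged alternately on both sides; by \<open>inj\<close> their union is the graph
  of a bijection.\<close>

lemma back_and_forth:
  fixes Q :: "'a \<Rightarrow> 'a \<Rightarrow> 'b \<Rightarrow> 'b \<Rightarrow> bool"
  defines "ok \<equiv> \<lambda>R. \<forall>(x, y)\<in>R. \<forall>(x', y')\<in>R. Q x x' y y'"
  assumes A: "countable A" and B: "countable B"
    and inj: "\<And>x x' y y'. Q x x' y y' \<Longrightarrow> x = x' \<longleftrightarrow> y = y'"
    and forward: "\<And>R a. finite R \<Longrightarrow> R \<subseteq> A \<times> B \<Longrightarrow> ok R \<Longrightarrow> a \<in> A \<Longrightarrow> \<exists>b\<in>B. ok (insert (a, b) R)"
    and backward: "\<And>R b. finite R \<Longrightarrow> R \<subseteq> A \<times> B \<Longrightarrow> ok R \<Longrightarrow> b \<in> B \<Longrightarrow> \<exists>a\<in>A. ok (insert (a, b) R)"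
  shows "\<exists>f. bij_betw f A B \<and> (\<forall>x\<in>A. \<forall>x'\<in>A. Q x x' (f x) (f x'))"
\<comment> \<open>Enumeration by \<open>from_nat_into\<close> needs nonempty sets.\<close>
proof (cases "A = {}")
  case True
  then have "B = {}" using backward[of "{}"] by (auto simp: ok_def)
  then show ?thesis using True by (intro exI[of _ undefined]) (auto simp: bij_betw_def)
next
  case False
  then have "B \<noteq> {}" using forward[of "{}"] by (auto simp: ok_def)
  define a where "a = from_nat_into A"
  define b where "b = from_nat_into B"
  have a: "range a = A" and b: "range b = B"
    using A B False \<open>B \<noteq> {}\<close> by (auto simp: a_def b_def)
  define P where "P R \<longleftrightarrow> finite R \<and> R \<subseteq> A \<times> B \<and> ok R" for R
  \<comment> \<open>Stage \<open>n\<close> takes care of the n-th element of each set; compatibility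
    of two pairs in the union is read off at a common later stage.\<close>
  have "\<exists>R. \<forall>n. P (R n) \<and> R n \<subseteq> R (Suc n) \<and> a n \<in> Domain (R (Suc n)) \<and> b n \<in> Range (R (Suc n))"
  proof (rule dependent_nat_choice)
    show "\<exists>R. P R" by (rule exI[of _ "{}"]) (simp add: P_def ok_def)
    fix R :: "('a \<times> 'b) set" and n assume R: "P R"
    have an: "a n \<in> A" and bn: "b n \<in> B" using a b by auto
    obtain y where y: "y \<in> B" "ok (insert (a n, y) R)"
      using forward[of R "a n"] R an by (auto simp: P_def)
    have P1: "P (insert (a n, y) R)" using R y an by (auto simp: P_def)
    obtain x where x: "x \<in> A" "ok (insert (x, b n) (insert (a n, y) R))"
      using backward[of "insert (a n, y) R" "b n"] P1 bn by (auto simp: P_def)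
    have "P (insert (x, b n) (insert (a n, y) R))" using P1 x bn by (auto simp: P_def)
    then show "\<exists>R'. P R' \<and> R \<subseteq> R' \<and> a n \<in> Domain R' \<and> b n \<in> Range R'"
      by (intro exI[of _ "insert (x, b n) (insert (a n, y) R)"]) auto
  qed
  then obtain R where R: "\<And>n. P (R n)" "\<And>n. R n \<subseteq> R (Suc n)"
    "\<And>n. a n \<in> Domain (R (Suc n))" "\<And>n. b n \<in> Range (R (Suc n))" by blast
  define T where "T = (\<Union>n. R n)"
  have mono: "R m \<subseteq> R n" if "m \<le> n" for m n using R(2) that by (rule lift_Suc_mono_le)
  have Q: "Q x x' y y'" if xy: "(x, y) \<in> T" "(x', y') \<in> T" for x x' y y'
  proof -
    obtain m n where "(x, y) \<in> R m" "(x', y') \<in> R n" using xy unfolding T_def by blast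
    then have "(x, y) \<in> R (max m n)" "(x', y') \<in> R (max m n)"
      using mono[of m "max m n"] mono[of n "max m n"] by auto
    then show ?thesis using R(1)[of "max m n"] by (auto simp: P_def ok_def)
  qed
  have sub: "T \<subseteq> A \<times> B" using R(1) by (auto simp: T_def P_def)
  have dom: "\<exists>y. (x, y) \<in> T" if xA: "x \<in> A" for x
  proof -
    obtain n where "x = a n" using a xA by auto
    then show ?thesis using R(3)[of n] by (auto simp: T_def)
  qed
  then obtain f where f: "\<And>x. x \<in> A \<Longrightarrow> (x, f x) \<in> T" by metis
  have "bij_betw f A B"
    unfolding bij_betw_def
  proof
    show "inj_on f A" using Q[OF f f] inj by (meson inj_onI)
    have "y \<in> f ` A" if yB: "y \<in> B" for y
    proof -
      obtain n where "y = b n" using b yB by auto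
      then obtain x where "(x, y) \<in> T" using R(4)[of n] by (auto simp: T_def)
      then show ?thesis using Q[OF _ f, of x y x] inj[of x x y "f x"] sub by auto
    qed
    then show "f ` A = B" using f sub by auto
  qed
  then show ?thesis using Q[OF f f] by blast
qed

text \<open>
  \<open>C\<close> decides closeness from the blocks \<open>a\<close> of two points and the order of their positions \<open>r\<close>
  inside the blocks.
\<close>

definition circle_coords ::
    "(int \<Rightarrow> int \<Rightarrow> bool \<Rightarrow> bool \<Rightarrow> bool) \<Rightarrow> int \<Rightarrow> real \<Rightarrow> real set \<Rightarrow> (real \<Rightarrow> int) \<Rightarrow> (real \<Rightarrow> real) \<Rightarrow> bool" where
  "circle_coords C l L S a r \<longleftrightarrow>
     (\<forall>u\<in>circle L. \<forall>v\<in>circle L. circle_dist L u v < 1 \<longleftrightarrow> C (a u) (a v) (r u < r v) (r v < r u)) \<and>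
     inj_on r S \<and> (\<forall>u\<in>S. 0 < r u \<and> r u < 1 \<and> 0 \<le> a u \<and> a u < l) \<and>
     (\<forall>k \<alpha> \<beta>. 0 \<le> k \<and> k < l \<and> 0 \<le> \<alpha> \<and> \<alpha> < \<beta> \<and> \<beta> \<le> 1 \<longrightarrow>
        (\<exists>U. open U \<and> U \<inter> {0<..<L} \<noteq> {} \<and> (\<forall>x\<in>U \<inter> circle L. a x = k \<and> \<alpha> < r x \<and> r x < \<beta>)))"

definition coords_match ::
    "(real \<Rightarrow> int) \<Rightarrow> (real \<Rightarrow> real) \<Rightarrow> real set set \<Rightarrow> (real \<Rightarrow> int) \<Rightarrow> (real \<Rightarrow> real) \<Rightarrow> real set set \<Rightarrow>
     real \<Rightarrow> real \<Rightarrow> real \<Rightarrow> real \<Rightarrow> bool" where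
  "coords_match a r E a' r' E' x y x' y' \<longleftrightarrow>
     (x = y \<longleftrightarrow> x' = y') \<and> a x = a' x' \<and> a y = a' y' \<and>
     (r x < r y \<longleftrightarrow> r' x' < r' y') \<and> (r y < r x \<longleftrightarrow> r' y' < r' x') \<and> ({x, y} \<in> E \<longleftrightarrow> {x', y'} \<in> E')"

lemma coords_match_sym:
  "coords_match a r E a' r' E' x y x' y' \<longleftrightarrow> coords_match a r E a' r' E' y x y' x'"
  by (auto simp: coords_match_def insert_commute)

lemma coords_match_swap:
  "coords_match a r E a' r' E' x y x' y' \<longleftrightarrow> coords_match a' r' E' a r E x' y' x y"
  by (auto simp: coords_match_def)

lemma circle_dist_sym: "circle_dist L u v = circle_dist L v u"
  by (simp add: circle_dist_def abs_minus_commute)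

lemma close_pairsD:
  assumes "{u, v} \<in> close_pairs L S"
  shows "u \<in> S" "v \<in> S" "u \<noteq> v" "circle_dist L u v < 1"
  using assms by (auto simp: close_pairs_def doubleton_eq_iff circle_dist_sym)

text \<open>One step of the back-and-forth. The new point goes into the block of \<open>u\<close>,
  with its offset in the window left by the matched points; there closeness to these points is
  already decided, so saturation can supply the adjacencies.\<close>

lemma coords_match_extend:
  assumes co: "circle_coords C l L S a r" and co': "circle_coords C l L S' a' r'"
    and E: "E \<subseteq> close_pairs L S" and E': "E' \<subseteq> close_pairs L S'" and sat: "saturated L S' E'"
    and S: "S \<subseteq> circle L" and S': "S' \<subseteq> circle L"
    and R: "finite R" "R \<subseteq> S \<times> S'"
      "\<And>x x' y y'. (x, x') \<in> R \<Longrightarrow> (y, y') \<in> R \<Longrightarrow> coords_match a r E a' r' E' x y x' y'"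
    and u: "u \<in> S"
  shows "\<exists>s\<in>S'. \<forall>(x, x')\<in>insert (u, s) R. \<forall>(y, y')\<in>insert (u, s) R. coords_match a r E a' r' E' x y x' y'"
proof (cases "u \<in> Domain R")
  case True
  then obtain s where "(u, s) \<in> R" by auto
  moreover from this have "s \<in> S'" using R(2) by auto
  ultimately show ?thesis using R(3) by (intro bexI[of _ s]) (auto simp: insert_absorb)
next
  case False
  have r01: "0 < r' y" "r' y < 1" if "(x, y) \<in> R" for x y
    using co' R(2) that by (auto simp: circle_coords_def)
  define D where "D = snd ` {z \<in> R. r (fst z) < r u}"
  define D' where "D' = snd ` {z \<in> R. r u < r (fst z)}"
  \<comment> \<open>The ends 0 and 1 of the offset range take over when no matched point has a
    smaller, respectively larger, offset than \<open>u\<close>.\<close>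
  define \<alpha> where "\<alpha> = Max (insert 0 (r' ` D))"
  define \<beta> where "\<beta> = Min (insert 1 (r' ` D'))"
  have fin: "finite D" "finite D'" using R(1) by (auto simp: D_def D'_def)
  have \<alpha>: "r' y \<le> \<alpha>" if "(x, y) \<in> R" "r x < r u" for x y
    unfolding \<alpha>_def using that fin by (intro Max_ge) (force simp: D_def)+
  have \<beta>: "\<beta> \<le> r' y" if "(x, y) \<in> R" "r u < r x" for x y
    unfolding \<beta>_def using that fin by (intro Min_le) (force simp: D'_def)+
  have lt: "r' y < r' y'" if "(x, y) \<in> R" "r x < r u" "(x', y') \<in> R" "r u < r x'" for x y x' y'
    using R(3)[OF that(1,3)] that(2,4) by (auto simp: coords_match_def)
  have "0 \<le> \<alpha>" "\<beta> \<le> 1" unfolding \<alpha>_def \<beta>_def using fin by auto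
  moreover have "\<alpha> < \<beta>"
    unfolding \<alpha>_def \<beta>_def using fin lt r01 by (auto simp: D_def D'_def)
  moreover have "0 \<le> a u" "a u < l" using co u by (auto simp: circle_coords_def)
  ultimately obtain U where U: "open U" "U \<inter> {0<..<L} \<noteq> {}"
    "\<And>x. x \<in> U \<inter> circle L \<Longrightarrow> a' x = a u \<and> \<alpha> < r' x \<and> r' x < \<beta>"
    using co' unfolding circle_coords_def by meson
  have order: "(r u < r x \<longleftrightarrow> r' s < r' y) \<and> (r x < r u \<longleftrightarrow> r' y < r' s) \<and> r' y \<noteq> r' s"
    if "s \<in> U \<inter> circle L" "(x, y) \<in> R" for s x y
  proof -
    have "x \<noteq> u" "x \<in> S" using that(2) False R(2) by auto
    then have "r x \<noteq> r u" using co u by (auto simp: circle_coords_def inj_on_def)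
    then show ?thesis using U(3)[OF that(1)] \<alpha>[OF that(2)] \<beta>[OF that(2)] by force
  qed
  have close: "circle_dist L s y < 1 \<longleftrightarrow> circle_dist L u x < 1"
    if "s \<in> U \<inter> circle L" "(x, y) \<in> R" for s x y
  proof -
    have "x \<in> circle L" "y \<in> circle L" "u \<in> circle L" using that u R(2) S S' by auto
    then have "circle_dist L s y < 1 \<longleftrightarrow> C (a' s) (a' y) (r' s < r' y) (r' y < r' s)"
      using co' that(1) by (simp_all add: circle_coords_def)
    moreover have "circle_dist L u x < 1 \<longleftrightarrow> C (a u) (a x) (r u < r x) (r x < r u)"
      using co \<open>x \<in> circle L\<close> \<open>u \<in> circle L\<close> by (simp add: circle_coords_def)
    moreover have "a x = a' y" using R(3)[OF that(2) that(2)] by (simp add: coords_match_def)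
    moreover have "a' s = a u" "(r' s < r' y) = (r u < r x)" "(r' y < r' s) = (r x < r u)"
      using order[OF that] U(3)[OF that(1)] by blast+
    ultimately show ?thesis by (simp only:)
  qed
  define A where "A = snd ` {z \<in> R. {u, fst z} \<in> E}"
  \<comment> \<open>Far points are left out of \<open>B\<close>: they cannot become neighbours,
    because \<open>E'\<close> consists of close pairs.\<close>
  define B where "B = snd ` {z \<in> R. {u, fst z} \<notin> E \<and> circle_dist L u (fst z) < 1}"
  have "A \<inter> B = {}"
  proof (rule ccontr)
    assume "A \<inter> B \<noteq> {}"
    then obtain x x' y where xy: "(x, y) \<in> R" "(x', y) \<in> R" "{u, x} \<in> E" "{u, x'} \<notin> E"
      unfolding A_def B_def by auto
    then have "x = x'" using R(3)[OF xy(1,2)] by (simp add: coords_match_def)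
    then show False using xy by simp
  qed
  moreover have "finite A" "finite B" "A \<subseteq> S'" "B \<subseteq> S'" using R(1,2) by (auto simp: A_def B_def)
  moreover have "\<forall>x\<in>U \<inter> circle L. \<forall>w\<in>A \<union> B. circle_dist L x w < 1"
  proof (intro ballI)
    fix x w assume x: "x \<in> U \<inter> circle L" and "w \<in> A \<union> B"
    then obtain v where "(v, w) \<in> R" "circle_dist L u v < 1"
      using E close_pairsD(4)[of u _ L S] unfolding A_def B_def by fastforce
    then show "circle_dist L x w < 1" using close[OF x] by blast
  qed
  ultimately have "\<exists>s\<in>S' \<inter> U. s \<notin> A \<union> B \<and> (\<forall>w\<in>A. {s, w} \<in> E') \<and> (\<forall>w\<in>B. {s, w} \<notin> E')"
    by (intro saturatedD[OF sat U(1,2)]) auto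
  then obtain s where s: "s \<in> S' \<inter> U" "\<And>w. w \<in> A \<Longrightarrow> {s, w} \<in> E'" "\<And>w. w \<in> B \<Longrightarrow> {s, w} \<notin> E'"
    by blast
  have sU: "s \<in> U \<inter> circle L" using s S' by auto
  have edge: "{s, y} \<in> E' \<longleftrightarrow> {u, x} \<in> E" if "(x, y) \<in> R" for x y
  proof (cases "circle_dist L u x < 1")
    case True
    then show ?thesis using s(2,3)[of y] that by (force simp: A_def B_def)
  next
    case False
    then have "{s, y} \<notin> close_pairs L S'" "{u, x} \<notin> close_pairs L S"
      using close[OF sU that] close_pairsD(4) by auto
    then show ?thesis using E E' by blast
  qed
  have new: "coords_match a r E a' r' E' u x s y" if "(x, y) \<in> R" for x y
    using order[OF sU that] edge[OF that] U(3)[OF sU] R(3)[OF that that] that False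
    by (auto simp: coords_match_def)
  have "{u, u} \<notin> E" "{s, s} \<notin> E'"
    using E E' close_pairsD(3) by blast+
  then have self: "coords_match a r E a' r' E' u u s s"
    using U(3)[OF sU] by (simp add: coords_match_def)
  show ?thesis
  proof (intro bexI[of _ s] ballI, clarify)
    fix x x' y y' assume "(x, x') \<in> insert (u, s) R" "(y, y') \<in> insert (u, s) R"
    then consider "(x, x') = (u, s)" "(y, y') = (u, s)" | "(x, x') = (u, s)" "(y, y') \<in> R"
      | "(x, x') \<in> R" "(y, y') = (u, s)" | "(x, x') \<in> R" "(y, y') \<in> R" by blast
    then show "coords_match a r E a' r' E' x y x' y'"
      using self new R(3) coords_match_sym by cases blast+
  qed (use s(1) in auto)
qed

lemma circle_coords_graph_iso:
  assumes co: "circle_coords C l L S a r" and co': "circle_coords C l L S' a' r'"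
    and E: "E \<subseteq> close_pairs L S" and E': "E' \<subseteq> close_pairs L S'"
    and sat: "saturated L S E" "saturated L S' E'"
    and S: "S \<subseteq> circle L" "countable S" and S': "S' \<subseteq> circle L" "countable S'"
  shows "(S, E) \<cong>\<^sub>G (S', E')"
proof -
  have "\<exists>f. bij_betw f S S' \<and> (\<forall>x\<in>S. \<forall>y\<in>S. coords_match a r E a' r' E' x y (f x) (f y))"
  proof (rule back_and_forth[where Q = "coords_match a r E a' r' E'"])
    fix R u assume R: "finite R" "R \<subseteq> S \<times> S'"
      "\<forall>(x, y)\<in>R. \<forall>(x', y')\<in>R. coords_match a r E a' r' E' x x' y y'"
    have R3: "coords_match a r E a' r' E' x y x' y'" if "(x, x') \<in> R" "(y, y') \<in> R" for x x' y y'
      using R(3) that by blast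
    {
      assume u: "u \<in> S"
      show "\<exists>s\<in>S'. \<forall>(x, x')\<in>insert (u, s) R. \<forall>(y, y')\<in>insert (u, s) R.
          coords_match a r E a' r' E' x y x' y'"
      proof (rule coords_match_extend[OF co co' E E' sat(2) S(1) S'(1) R(1,2) _ u])
        fix x x' y y' assume "(x, x') \<in> R" "(y, y') \<in> R"
        then show "coords_match a r E a' r' E' x y x' y'" by (rule R3)
      qed
    next
      assume u: "u \<in> S'"
      \<comment> \<open>The backward step is the forward step for the converse relation with the two
        graphs exchanged.\<close>
      have "\<exists>s\<in>S. \<forall>(x, x')\<in>insert (u, s) (R\<inverse>). \<forall>(y, y')\<in>insert (u, s) (R\<inverse>).
          coords_match a' r' E' a r E x y x' y'"
      proof (rule coords_match_extend[OF co' co E' E sat(1) S'(1) S(1) _ _ _ u])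
        fix x x' y y' assume "(x, x') \<in> R\<inverse>" "(y, y') \<in> R\<inverse>"
        then show "coords_match a' r' E' a r E x y x' y'"
          by (subst coords_match_swap) (rule R3, auto)
      qed (use R(1,2) in auto)
      then obtain s where s: "s \<in> S" "\<forall>(x, x')\<in>insert (u, s) (R\<inverse>). \<forall>(y, y')\<in>insert (u, s) (R\<inverse>).
          coords_match a' r' E' a r E x y x' y'" by blast
      have "coords_match a r E a' r' E' x y x' y'"
        if "(x, x') \<in> insert (s, u) R" "(y, y') \<in> insert (s, u) R" for x x' y y'
      proof -
        have "(x', x) \<in> insert (u, s) (R\<inverse>)" "(y', y) \<in> insert (u, s) (R\<inverse>)" using that by auto
        then show ?thesis using s(2) by (subst coords_match_swap) blast
      qed
      then show "\<exists>s\<in>S. \<forall>(x, x')\<in>insert (s, u) R. \<forall>(y, y')\<in>insert (s, u) R.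
          coords_match a r E a' r' E' x y x' y'"
        using s(1) by (intro bexI[of _ s]) blast+
    }
  next
    show "countable S" "countable S'" by fact+
    show "x = x' \<longleftrightarrow> y = y'" if "coords_match a r E a' r' E' x x' y y'" for x x' y y'
      using that by (simp add: coords_match_def)
  qed
  then obtain f where "bij_betw f S S'" "\<And>x y. x \<in> S \<Longrightarrow> y \<in> S \<Longrightarrow> coords_match a r E a' r' E' x y (f x) (f y)"
    by blast
  then show ?thesis
    unfolding graph_iso_def by (intro exI[of _ f]) (simp add: coords_match_def)
qed

text \<open>
  \<open>p\<close> and \<open>q\<close> say that the offset of the first point is smaller, respectively larger, than that of
  the second.
\<close>

definition block_close :: "int \<Rightarrow> int \<Rightarrow> int \<Rightarrow> int \<Rightarrow> bool \<Rightarrow> bool \<Rightarrow> bool" where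
  "block_close l m i j p q \<longleftrightarrow>
     (i - j < m \<or> i - j = m \<and> p) \<and> (j - i < m \<or> j - i = m \<and> q) \<or>
     (i - j > l - m \<or> i - j = l - m \<and> q) \<or> (j - i > l - m \<or> j - i = l - m \<and> p)"

section \<open>Closeness in terms of floors and fractional parts\<close>

text \<open>Fractional parts differ by less than 1, so they matter only when the floors differ by
  exactly \<open>k\<close>.\<close>

lemma diff_less_of_int_iff:
  fixes t t' :: real
  shows "t - t' < of_int k \<longleftrightarrow> \<lfloor>t\<rfloor> - \<lfloor>t'\<rfloor> < k \<or> \<lfloor>t\<rfloor> - \<lfloor>t'\<rfloor> = k \<and> frac t < frac t'"
proof -
  have f: "t = of_int \<lfloor>t\<rfloor> + frac t" "t' = of_int \<lfloor>t'\<rfloor> + frac t'" by (simp_all add: frac_def)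
  have "0 \<le> frac t" "frac t < 1" "0 \<le> frac t'" "frac t' < 1" by (simp_all add: frac_lt_1)
  consider "\<lfloor>t\<rfloor> - \<lfloor>t'\<rfloor> = k" | "\<lfloor>t\<rfloor> - \<lfloor>t'\<rfloor> \<le> k - 1" | "\<lfloor>t\<rfloor> - \<lfloor>t'\<rfloor> \<ge> k + 1" by linarith
  then show ?thesis
  proof cases
    case 1
    then have "real_of_int k = of_int \<lfloor>t\<rfloor> - of_int \<lfloor>t'\<rfloor>" by simp
    then show ?thesis using 1 f by auto
  next
    case 2
    then have "real_of_int \<lfloor>t\<rfloor> - of_int \<lfloor>t'\<rfloor> \<le> of_int k - 1" by linarith
    then show ?thesis using 2 f \<open>frac t < 1\<close> \<open>0 \<le> frac t'\<close> by linarith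
  next
    case 3
    then have "real_of_int \<lfloor>t\<rfloor> - of_int \<lfloor>t'\<rfloor> \<ge> of_int k + 1" by linarith
    then show ?thesis using 3 f \<open>frac t' < 1\<close> \<open>0 \<le> frac t\<close> by linarith
  qed
qed

lemma diff_greater_of_int_iff:
  fixes t t' :: real
  shows "t - t' > of_int k \<longleftrightarrow> \<lfloor>t\<rfloor> - \<lfloor>t'\<rfloor> > k \<or> \<lfloor>t\<rfloor> - \<lfloor>t'\<rfloor> = k \<and> frac t' < frac t"
  using diff_less_of_int_iff[of t' t "- k"] by auto

text \<open>On the circle scaled up by \<open>m\<close>, which has length \<open>l\<close>, the
  left-hand side is the condition that the unscaled circular distance is below 1.\<close>

lemma abs_diff_less_or_greater_iff:
  fixes t t' :: real
  shows "\<bar>t - t'\<bar> < of_int m \<or> \<bar>t - t'\<bar> > of_int (l - m) \<longleftrightarrow>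
     block_close l m \<lfloor>t\<rfloor> \<lfloor>t'\<rfloor> (frac t < frac t') (frac t' < frac t)"
proof -
  have "\<bar>t - t'\<bar> < of_int m \<longleftrightarrow> t - t' < of_int m \<and> t' - t < of_int m" by linarith
  moreover have "\<bar>t - t'\<bar> > of_int (l - m) \<longleftrightarrow> t - t' > of_int (l - m) \<or> t' - t > of_int (l - m)"
    by linarith
  ultimately show ?thesis
    unfolding diff_less_of_int_iff diff_greater_of_int_iff block_close_def by blast
qed

text \<open>Rotating by a suitable \<open>c\<close> moves \<open>S\<close> off the block boundaries, the multiples of \<open>1 / m\<close>.\<close>

lemma ex_circle_coords:
  fixes l m :: int
  assumes m: "m > 0" and L: "L = of_int l / of_int m" "L > 0"
    and S: "countable S" "S \<subseteq> circle L"
    and free: "\<And>u v k. u \<in> S \<Longrightarrow> v \<in> S \<Longrightarrow> u \<noteq> v \<Longrightarrow> circle_dist L u v \<noteq> of_int k / of_int m"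
  shows "\<exists>a r. circle_coords (block_close l m) l L S a r"
proof -
  have lm: "of_int m * L = real_of_int l" using m L by simp
  have l: "l > 0" using L m by (simp add: zero_less_divide_iff)
  \<comment> \<open>Each point of \<open>S\<close> forbids only countably many positions of the cut
    \<open>c\<close>.\<close>
  have "uncountable {0<..<L}" using L by (simp add: uncountable_open_interval)
  moreover have "countable ((\<lambda>(u, k). u - of_int k / of_int m) ` (S \<times> (UNIV :: int set)))"
    using S by auto
  ultimately obtain c where c: "0 < c" "c < L"
    and cS: "c \<notin> (\<lambda>(u, k). u - of_int k / of_int m) ` (S \<times> (UNIV :: int set))"
    by (metis (no_types, lifting) countable_subset greaterThanLessThan_iff subsetI)
  have off: "u - c \<noteq> of_int k / of_int m" if "u \<in> S" for u and k :: int
    using cS that by (auto simp: image_iff algebra_simps)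
  \<comment> \<open>\<open>x u\<close> is the position measured from the cut at \<open>c\<close>.
    Scaling by \<open>m\<close> gives blocks of length 1, so the floor of \<open>t u\<close> is the
    block and \<open>frac (t u)\<close> the offset.\<close>
  define x where "x u = (if c \<le> u then u - c else u - c + L)" for u
  define t where "t u = of_int m * x u" for u
  have x: "0 \<le> x u" "x u < L" if "u \<in> circle L" for u
    using that c by (auto simp: x_def circle_def)
  have t: "0 \<le> t u" "t u < of_int l" if "u \<in> circle L" for u
    using x[OF that] m lm by (auto simp: t_def) (metis mult_less_cancel_left_pos of_int_0_less_iff)
  have dist: "circle_dist L u v = circle_dist L (x u) (x v)" if "u \<in> circle L" "v \<in> circle L" for u v
    using that c by (auto simp: circle_dist_def x_def circle_def min_def abs_if)
  have tdiff: "\<bar>t u - t v\<bar> = of_int m * \<bar>x u - x v\<bar>" for u v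
    using m by (simp add: t_def abs_mult flip: right_diff_distrib)
  have close: "circle_dist L u v < 1 \<longleftrightarrow> block_close l m \<lfloor>t u\<rfloor> \<lfloor>t v\<rfloor> (frac (t u) < frac (t v)) (frac (t v) < frac (t u))"
    if "u \<in> circle L" "v \<in> circle L" for u v
  proof -
    have "circle_dist L u v < 1 \<longleftrightarrow> \<bar>x u - x v\<bar> < 1 \<or> L - 1 < \<bar>x u - x v\<bar>"
      unfolding dist[OF that] by (auto simp: circle_dist_def)
    also have "\<dots> \<longleftrightarrow> of_int m * \<bar>x u - x v\<bar> < of_int m * 1 \<or> of_int m * (L - 1) < of_int m * \<bar>x u - x v\<bar>"
      using m by (simp add: mult_less_cancel_left_pos)
    also have "\<dots> \<longleftrightarrow> \<bar>t u - t v\<bar> < of_int m \<or> \<bar>t u - t v\<bar> > of_int (l - m)"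
      unfolding tdiff using lm by (simp add: algebra_simps)
    finally show ?thesis unfolding abs_diff_less_or_greater_iff .
  qed
  \<comment> \<open>No point of \<open>S\<close> sits on a block boundary, which makes the offsets
    strictly positive.\<close>
  have nonint: "t u \<noteq> of_int k" if "u \<in> S" for u k
  proof
    assume "t u = of_int k"
    then have "x u = of_int k / of_int m" using m by (simp add: t_def field_simps)
    then have "u - c = of_int k / of_int m \<or> u - c = of_int (k - l) / of_int m"
      using L m by (auto simp: x_def field_simps split: if_splits)
    then show False using off[OF that] by blast
  qed
  \<comment> \<open>Equal offsets make \<open>\<bar>t u - t v\<bar>\<close> an integer
    \<open>k\<close>, so the circular distance is \<open>k / m\<close> or
    \<open>(l - k) / m\<close>, which \<open>free\<close> forbids.\<close>
  have inj: "inj_on (\<lambda>u. frac (t u)) S"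
  proof (rule inj_onI, rule ccontr)
    fix u v assume uv: "u \<in> S" "v \<in> S" "frac (t u) = frac (t v)" "u \<noteq> v"
    define k where "k = \<bar>\<lfloor>t u\<rfloor> - \<lfloor>t v\<rfloor>\<bar>"
    have "\<bar>t u - t v\<bar> = of_int k" using uv(3) by (simp add: frac_def k_def)
    then have k: "\<bar>x u - x v\<bar> = of_int k / of_int m" using tdiff[of u v] m by (simp add: field_simps)
    have "circle_dist L u v = circle_dist L (x u) (x v)"
      using uv S by (intro dist) auto
    also have "\<dots> = min (of_int k / of_int m) (L - of_int k / of_int m)"
      by (simp add: circle_dist_def k)
    also have "L - of_int k / of_int m = of_int (l - k) / of_int m"
      using L by (simp add: diff_divide_distrib)
    finally show False
      using free[OF uv(1,2,4), of k] free[OF uv(1,2,4), of "l - k"] by (simp only: min_def split: if_splits)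
  qed
  have block: "\<exists>U. open U \<and> U \<inter> {0<..<L} \<noteq> {} \<and>
      (\<forall>u\<in>U \<inter> circle L. \<lfloor>t u\<rfloor> = k \<and> \<alpha> < frac (t u) \<and> frac (t u) < \<beta>)"
    if k: "0 \<le> k" "k < l" and ab: "0 \<le> \<alpha>" "\<alpha> < \<beta>" "\<beta> \<le> 1" for k :: int and \<alpha> \<beta> :: real
  proof -
    \<comment> \<open>\<open>U1\<close> and \<open>U2\<close> are the parts of the wanted offset
      window on the two sides of the cut.\<close>
    define U1 where "U1 = {u. c < u \<and> of_int k + \<alpha> < of_int m * (u - c) \<and> of_int m * (u - c) < of_int k + \<beta>}"
    define U2 where "U2 = {u. u < c \<and> of_int k + \<alpha> < of_int m * (u - c + L) \<and> of_int m * (u - c + L) < of_int k + \<beta>}"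
    have "open (U1 \<union> U2)"
      unfolding U1_def U2_def by (intro open_Un open_Collect_conj open_Collect_less continuous_intros)
    moreover have "(U1 \<union> U2) \<inter> {0<..<L} \<noteq> {}"
    proof -
      \<comment> \<open>Two candidates are offered so that one of them avoids the parameter of the
        point 0, which lies outside \<open>{0<..<L}\<close>.\<close>
      have "of_int k + \<alpha> < of_int k + (2 * \<alpha> + \<beta>) / 3" "of_int k + (2 * \<alpha> + \<beta>) / 3 < of_int k + \<beta>"
        "of_int k + \<alpha> < of_int k + (\<alpha> + 2 * \<beta>) / 3" "of_int k + (\<alpha> + 2 * \<beta>) / 3 < of_int k + \<beta>"
        "of_int k + (2 * \<alpha> + \<beta>) / 3 < of_int k + (\<alpha> + 2 * \<beta>) / 3"
        using ab by auto
      then obtain z where z: "of_int k + \<alpha> < z" "z < of_int k + \<beta>" "z \<noteq> of_int m * (L - c)"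
        by (metis less_irrefl)
      have z0: "0 < z" "z < of_int m * L"
      proof -
        have "real_of_int k \<ge> 0" "real_of_int k + 1 \<le> of_int l" using k by linarith+
        then show "0 < z" "z < of_int m * L" using z ab lm by linarith+
      qed
      define y where "y = z / of_int m"
      have zy: "z = of_int m * y" using m by (simp add: y_def)
      have y: "0 < y" "y < L" "y \<noteq> L - c" using z0 z(3) m unfolding zy by (auto simp: zero_less_mult_iff)
      show ?thesis
      proof (cases "y < L - c")
        case True
        then have "c + y \<in> U1 \<inter> {0<..<L}" using y c z unfolding U1_def zy by simp
        then show ?thesis by blast
      next
        case False
        then have "c + y - L \<in> U2 \<inter> {0<..<L}" using y c z unfolding U2_def zy by simp
        then show ?thesis by blast
      qed
    qed
    moreover have "\<lfloor>t u\<rfloor> = k \<and> \<alpha> < frac (t u) \<and> frac (t u) < \<beta>" if "u \<in> (U1 \<union> U2) \<inter> circle L" for u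
    proof -
      have "of_int k + \<alpha> < t u" "t u < of_int k + \<beta>"
        using that by (auto simp: t_def x_def U1_def U2_def)
      moreover from this have "\<lfloor>t u\<rfloor> = k" using ab by (intro floor_unique) auto
      ultimately show ?thesis by (simp add: frac_def)
    qed
    ultimately show ?thesis by (intro exI[of _ "U1 \<union> U2"]) simp
  qed
  have "circle_coords (block_close l m) l L S (\<lambda>u. \<lfloor>t u\<rfloor>) (\<lambda>u. frac (t u))"
    unfolding circle_coords_def
  proof (intro conjI)
    show "\<forall>u\<in>S. 0 < frac (t u) \<and> frac (t u) < 1 \<and> 0 \<le> \<lfloor>t u\<rfloor> \<and> \<lfloor>t u\<rfloor> < l"
    proof
      fix u assume u: "u \<in> S"
      then have "frac (t u) \<noteq> 0" using nonint[OF u] by (auto simp: frac_eq_0_iff elim!: Ints_cases)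
      then show "0 < frac (t u) \<and> frac (t u) < 1 \<and> 0 \<le> \<lfloor>t u\<rfloor> \<and> \<lfloor>t u\<rfloor> < l"
        using t[of u] u S frac_ge_0[of "t u"] frac_lt_1[of "t u"]
        by (auto simp: floor_less_iff simp del: frac_ge_0)
    qed
  qed (simp_all add: close inj block)
  then show ?thesis by blast
qed

lemma saturated_graph_iso_rational:
  assumes "L > 0" "integer_distance_free L S" "integer_distance_free L S'"
    and S: "S \<subseteq> circle L" "countable S" and S': "S' \<subseteq> circle L" "countable S'"
    and E: "E \<subseteq> close_pairs L S" "saturated L S E" and E': "E' \<subseteq> close_pairs L S'" "saturated L S' E'"
  shows "(S, E) \<cong>\<^sub>G (S', E')"
proof -
  obtain l m :: nat where lm: "m > 0" "coprime l m" "L = real l / real m"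
    and free: "\<And>u v k. u \<in> S \<Longrightarrow> v \<in> S \<Longrightarrow> u \<noteq> v \<Longrightarrow> circle_dist L u v \<noteq> of_int k * (1 / real m)"
    using assms(2) unfolding integer_distance_free_def by metis
  obtain l' m' :: nat where lm': "m' > 0" "coprime l' m'" "L = real l' / real m'"
    and free': "\<And>u v k. u \<in> S' \<Longrightarrow> v \<in> S' \<Longrightarrow> u \<noteq> v \<Longrightarrow> circle_dist L u v \<noteq> of_int k * (1 / real m')"
    using assms(3) unfolding integer_distance_free_def by metis
  \<comment> \<open>Lowest terms are unique, so both sets share \<open>l\<close> and
    \<open>m\<close> and hence the same closeness rule.\<close>
  have "real (l * m') = real (l' * m)" using lm lm' by (simp add: field_simps)
  then have "l * m' = l' * m" using of_nat_eq_iff by blast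
  then have eq: "l = l'" "m = m'"
    using lm lm' coprime_crossproduct_nat[of l m l' m'] by (auto simp: coprime_commute mult.commute)
  obtain a r where "circle_coords (block_close (int l) (int m)) (int l) L S a r"
    using ex_circle_coords[of "int m" L "int l" S] lm free S assms(1) by auto
  moreover obtain a' r' where "circle_coords (block_close (int l) (int m)) (int l) L S' a' r'"
    using ex_circle_coords[of "int m" L "int l" S'] lm free' S' assms(1) eq by auto
  ultimately show ?thesis
    using circle_coords_graph_iso E E' S S' by blast
qed

section \<open>The circle in the complex plane\<close>

text \<open>Winds the real line around the unit circle with period \<open>L\<close>, for nonzero
  \<open>L\<close>. Translations become multiplications, and reflections involve
  conjugation.\<close>

definition circle_point :: "real \<Rightarrow> real \<Rightarrow> complex" where
  "circle_point L t = cis (2 * pi * t / L)"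

text \<open>Euclidean distance of two circle points whose parameters differ by \<open>d\<close>. It
  increases on \<open>[0, L / 2]\<close>, so for \<open>L \<ge> 2\<close> comparing it with
  \<open>chord L 1\<close> compares circular distance with 1.\<close>

definition chord :: "real \<Rightarrow> real \<Rightarrow> real" where
  "chord L d = 2 * \<bar>sin (pi * d / L)\<bar>"

lemma circle_point_add: "circle_point L (s + t) = circle_point L s * circle_point L t"
  by (simp add: circle_point_def cis_mult ring_distribs add_divide_distrib)

lemma circle_point_minus: "circle_point L (- t) = cnj (circle_point L t)"
  by (simp add: circle_point_def cis_cnj)

lemma circle_point_0 [simp]: "circle_point L 0 = 1"
  by (simp add: circle_point_def)

lemma circle_point_period: "L \<noteq> 0 \<Longrightarrow> circle_point L L = 1"
  by (simp add: circle_point_def)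

lemma circle_point_period_int: "L \<noteq> 0 \<Longrightarrow> circle_point L (of_int k * L) = 1"
  using cis_multiple_2pi[of "of_int k"] by (simp add: circle_point_def mult.assoc)

lemma norm_circle_point [simp]: "norm (circle_point L t) = 1"
  by (simp add: circle_point_def)

lemma circle_point_nonzero [simp]: "circle_point L t \<noteq> 0"
  by (metis norm_circle_point norm_zero zero_neq_one)

lemma continuous_on_circle_point [continuous_intros]:
  "continuous_on A f \<Longrightarrow> continuous_on A (\<lambda>x. circle_point L (f x))"
  unfolding circle_point_def cis_conv_exp divide_inverse by (intro continuous_intros)

lemma dist_circle_point: "dist (circle_point L s) (circle_point L t) = chord L (s - t)"
proof -
  have "circle_point L s - circle_point L t = circle_point L t * (circle_point L (s - t) - 1)"
    by (simp add: ring_distribs flip: circle_point_add)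
  then have "dist (circle_point L s) (circle_point L t) = norm (circle_point L (s - t) - 1)"
    by (simp add: dist_norm norm_mult)
  then show ?thesis
    using dist_exp_i_1[of "2 * pi * (s - t) / L"] by (simp add: circle_point_def cis_conv_exp chord_def)
qed

lemma chord_minus: "chord L (- d) = chord L d"
  by (simp add: chord_def)

lemma chord_abs: "chord L \<bar>d\<bar> = chord L d"
  by (simp add: abs_if chord_minus)

lemma chord_refl: "L \<noteq> 0 \<Longrightarrow> chord L (L - d) = chord L d"
  by (simp add: chord_def right_diff_distrib diff_divide_distrib)

lemma chord_less_iff:
  assumes "0 \<le> d" "d \<le> L / 2" "0 \<le> d'" "d' \<le> L / 2" "L > 0"
  shows "chord L d < chord L d' \<longleftrightarrow> d < d'"
proof -
  have *: "- (pi / 2) \<le> pi * d / L" "pi * d / L \<le> pi / 2" "0 \<le> pi * d / L" "pi * d / L \<le> pi"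
    if "0 \<le> d" "d \<le> L / 2" for d
    using that assms(5) by (auto simp: field_simps intro: order_trans[of _ 0])
  have "chord L d = 2 * sin (pi * d / L)" if "0 \<le> d" "d \<le> L / 2" for d
    using sin_ge_zero[OF *(3,4)[OF that]] by (simp add: chord_def)
  then have "chord L d < chord L d' \<longleftrightarrow> sin (pi * d / L) < sin (pi * d' / L)"
    using assms by simp
  also have "\<dots> \<longleftrightarrow> pi * d / L < pi * d' / L"
    by (intro sin_mono_less_eq *[OF assms(1,2)] *[OF assms(3,4)])
  also have "\<dots> \<longleftrightarrow> d < d'" using assms(5) by (simp add: divide_less_cancel)
  finally show ?thesis .
qed

lemma chord_less_1: "L \<ge> 2 \<Longrightarrow> \<bar>d\<bar> < 1 \<Longrightarrow> chord L d < chord L 1"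
  using chord_less_iff[of "\<bar>d\<bar>" L 1] by (simp add: chord_abs)

lemma chord_greater_1:
  assumes "1 < d" "d < L - 1"
  shows "chord L d > chord L 1"
proof (cases "d \<le> L / 2")
  case True
  then show ?thesis using chord_less_iff[of 1 L d] assms by simp
next
  case False
  then have "chord L (L - d) > chord L 1" using chord_less_iff[of 1 L "L - d"] assms by simp
  then show ?thesis using assms by (simp add: chord_refl)
qed

lemma dist_circle_point_circle_dist:
  assumes "u \<in> circle L" "v \<in> circle L"
  shows "dist (circle_point L u) (circle_point L v) = chord L (circle_dist L u v)"
proof -
  have "L \<noteq> 0" using assms by (auto simp: circle_def)
  then show ?thesis
    unfolding dist_circle_point circle_dist_def by (simp add: min_def chord_refl chord_abs)
qed

lemma dist_circle_point_less_iff: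
  assumes "u \<in> circle L" "v \<in> circle L" "L \<ge> 2"
  shows "dist (circle_point L u) (circle_point L v) < chord L 1 \<longleftrightarrow> circle_dist L u v < 1"
  unfolding dist_circle_point_circle_dist[OF assms(1,2)] using assms
  by (intro chord_less_iff) (auto simp: circle_dist_def circle_def min_def)

text \<open>The principal argument of \<open>z / circle_point L t\<close> has size at most
  \<open>pi\<close>, which is half a turn.\<close>

lemma ex_circle_point:
  assumes "L > 0" "norm z = 1"
  shows "\<exists>s. z = circle_point L s \<and> \<bar>s - t\<bar> \<le> L / 2"
proof -
  define \<theta> where "\<theta> = Arg (z / circle_point L t)"
  have n: "norm (z / circle_point L t) = 1" using assms by (simp add: norm_divide)
  then have "z / circle_point L t \<noteq> 0" by (metis norm_zero zero_neq_one)
  then have "cis \<theta> = z / circle_point L t"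
    unfolding \<theta>_def using n by (simp add: cis_Arg sgn_eq)
  moreover have "cis \<theta> = circle_point L (L * \<theta> / (2 * pi))"
    using assms by (simp add: circle_point_def)
  ultimately have "z = circle_point L (L * \<theta> / (2 * pi)) * circle_point L t"
    by (simp add: field_simps)
  then have "z = circle_point L (t + L * \<theta> / (2 * pi))"
    by (simp add: circle_point_add mult.commute)
  moreover have "\<bar>\<theta>\<bar> \<le> pi"
    unfolding \<theta>_def using mpi_less_Arg[of "z / circle_point L t"] Arg_le_pi[of "z / circle_point L t"] by linarith
  then have "\<bar>L * \<theta> / (2 * pi)\<bar> \<le> L / 2"
    using assms by (simp add: abs_mult abs_divide field_simps)
  ultimately show ?thesis by (intro exI[of _ "t + L * \<theta> / (2 * pi)"]) simp
qed

lemma ex_circle_point_circle: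
  assumes "L > 0" "norm z = 1"
  shows "\<exists>s\<in>circle L. z = circle_point L s"
proof -
  obtain s where "z = circle_point L s" "\<bar>s - L / 2\<bar> \<le> L / 2" using ex_circle_point[OF assms] by blast
  moreover from this have "0 \<le> s" "s \<le> L" by linarith+
  ultimately show ?thesis
    using assms circle_point_period[of L]
    by (cases "s = L") (auto simp: circle_def intro: bexI[of _ s] bexI[of _ 0])
qed

lemma inj_on_circle_point: "L > 0 \<Longrightarrow> inj_on (circle_point L) (circle L)"
proof (rule inj_onI)
  fix u v assume L: "L > 0" and uv: "u \<in> circle L" "v \<in> circle L" "circle_point L u = circle_point L v"
  have "chord L (circle_dist L u v) = chord L 0"
    using dist_circle_point_circle_dist[OF uv(1,2)] uv(3) by (simp add: chord_def)
  then have "\<not> 0 < circle_dist L u v"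
    using chord_less_iff[of 0 L "circle_dist L u v"] L uv by (auto simp: circle_dist_def circle_def min_def)
  then show "u = v" using uv(1,2) by (auto simp: circle_dist_def circle_def)
qed

text \<open>With the parameter of \<open>z\<close> chosen within half a turn of \<open>t\<close>,
  the chord length determines the size of the parameter difference.\<close>

lemma dist_eq_chord_1:
  assumes "L \<ge> 2" "norm z = 1" "dist z (circle_point L t) = chord L 1"
  shows "z = circle_point L (t + 1) \<or> z = circle_point L (t - 1)"
proof -
  obtain s where s: "z = circle_point L s" "\<bar>s - t\<bar> \<le> L / 2" using ex_circle_point[of L z t] assms by auto
  have "chord L \<bar>s - t\<bar> = chord L 1" using assms(3) by (simp add: s dist_circle_point chord_abs)
  then have "\<bar>s - t\<bar> = 1"
    using chord_less_iff[of "\<bar>s - t\<bar>" L 1] chord_less_iff[of 1 L "\<bar>s - t\<bar>"] s(2) assms(1) by force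
  then have "s = t + 1 \<or> s = t - 1" by linarith
  then show ?thesis using s(1) by blast
qed

section \<open>Unit balls on the circle\<close>

text \<open>Unit balls tell points apart: moving from \<open>v\<close> away from \<open>x\<close>,
  one can stay within 1 of \<open>v\<close> while getting farther than 1 from
  \<open>x\<close>.\<close>

lemma chord_balls_separate:
  fixes x v :: complex
  assumes L: "L > 2" and xv: "norm x = 1" "norm v = 1" "x \<noteq> v"
  shows "\<exists>y. norm y = 1 \<and> dist y v < chord L 1 \<and> dist y x > chord L 1"
proof -
  obtain s where s: "x = circle_point L s" using ex_circle_point[of L x] L xv by auto
  obtain t where t: "v = circle_point L t" "\<bar>t - s\<bar> \<le> L / 2" using ex_circle_point[of L v s] L xv by auto
  define D where "D = \<bar>t - s\<bar>"
  have D: "0 < D" "D \<le> L / 2" using s t xv by (auto simp: D_def)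
  \<comment> \<open>\<open>D + \<tau>\<close> must lie strictly between 1 and \<open>L - 1\<close>,
    and \<tau> strictly between 0 and 1; the room comes from \<open>L > 2\<close> and
    \<open>D \<le> L / 2\<close>.\<close>
  have "max 0 (1 - D) < min 1 (L - 1 - D)" using D L by auto
  then obtain \<tau> where \<tau>: "max 0 (1 - D) < \<tau>" "\<tau> < min 1 (L - 1 - D)" using dense by blast
  define y where "y = circle_point L (t + sgn (t - s) * \<tau>)"
  have "dist y v < chord L 1"
    unfolding y_def t dist_circle_point using \<tau> L by (intro chord_less_1) (auto simp: abs_mult sgn_if)
  moreover have "\<bar>t + sgn (t - s) * \<tau> - s\<bar> = D + \<tau>"
    using \<tau> D by (auto simp: D_def sgn_if)
  then have "dist y x = chord L (D + \<tau>)"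
    unfolding y_def s dist_circle_point by (metis chord_abs)
  then have "dist y x > chord L 1" using chord_greater_1[of "D + \<tau>" L] \<tau> by auto
  ultimately show ?thesis by (intro exI[of _ y]) (simp add: y_def)
qed

text \<open>Sliding \<open>v\<close> slightly along a shortest arc towards \<open>z\<close> brings
  its distance strictly below 1 and keeps it in \<open>W\<close>.\<close>

lemma chord_ball_approach:
  fixes z v :: complex
  assumes L: "L \<ge> 2" and z: "norm z = 1" "norm v = 1" "dist v z \<le> chord L 1" and W: "open W" "v \<in> W"
  shows "\<exists>x\<in>W. norm x = 1 \<and> dist x z < chord L 1"
proof -
  obtain s where s: "z = circle_point L s" using ex_circle_point[of L z] L z by auto
  obtain t where t: "v = circle_point L t" "\<bar>t - s\<bar> \<le> L / 2" using ex_circle_point[of L v s] L z by auto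
  have "\<not> chord L 1 < chord L \<bar>t - s\<bar>" using z(3) s t by (simp add: dist_circle_point chord_abs)
  then have ts: "\<bar>t - s\<bar> \<le> 1" using chord_less_iff[of 1 L "\<bar>t - s\<bar>"] t(2) L by auto
  define c where "c \<tau> = circle_point L (t + \<tau> * (s - t))" for \<tau>
  have "open (c -` W)"
    unfolding c_def by (intro open_vimage W continuous_intros)
  moreover have "0 \<in> c -` W" using W t by (simp add: c_def)
  ultimately obtain r where r: "r > 0" "ball 0 r \<subseteq> c -` W" using openE by blast
  define \<tau> where "\<tau> = min 1 (r / 2)"
  have \<tau>: "0 < \<tau>" "\<tau> \<le> 1" "\<tau> < r" using r by (auto simp: \<tau>_def)
  have "c \<tau> \<in> W" using r(2) \<tau> by (auto simp: subset_eq dist_real_def)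
  moreover have "dist (c \<tau>) z < chord L 1"
    unfolding c_def s dist_circle_point
  proof (rule chord_less_1[OF L])
    have "t + \<tau> * (s - t) - s = (1 - \<tau>) * (t - s)" by (simp add: algebra_simps)
    then have "\<bar>t + \<tau> * (s - t) - s\<bar> = (1 - \<tau>) * \<bar>t - s\<bar>" using \<tau> by (simp add: abs_mult)
    also have "\<dots> \<le> (1 - \<tau>) * 1" using ts \<tau> by (intro mult_left_mono) auto
    finally show "\<bar>t + \<tau> * (s - t) - s\<bar> < 1" using \<tau> by simp
  qed
  ultimately show ?thesis by (intro bexI[of _ "c \<tau>"]) (simp_all add: c_def)
qed

lemma circle_point_vimage_meets:
  assumes L: "L > 0" and W: "open W" "x \<in> W" "norm x = 1"
  shows "open (circle_point L -` W)" "circle_point L -` W \<inter> {0<..<L} \<noteq> {}"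
proof -
  show op: "open (circle_point L -` W)"
    using W(1) by (intro open_vimage continuous_intros)
  obtain t where t: "t \<in> circle L" "x = circle_point L t" using ex_circle_point_circle L W by blast
  then have "t \<in> circle_point L -` W" using W by simp
  then obtain r where r: "r > 0" "ball t r \<subseteq> circle_point L -` W" using op openE by blast
  \<comment> \<open>The parameter \<open>t\<close> may be 0; a small shift moves it into the open
    interval without leaving the preimage.\<close>
  define \<delta> where "\<delta> = min (r / 2) ((L - t) / 2)"
  have "0 < \<delta>" "\<delta> < r" "\<delta> < L - t"
    using r t by (auto simp: \<delta>_def circle_def min_less_iff_disj)
  then have "t + \<delta> \<in> ball t r" "t + \<delta> \<in> {0<..<L}" using t by (auto simp: dist_real_def circle_def)
  then have "t + \<delta> \<in> circle_point L -` W \<inter> {0<..<L}" using r by blast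
  then show "circle_point L -` W \<inter> {0<..<L} \<noteq> {}" by blast
qed

text \<open>Saturation with no forbidden neighbours, applied to the part of \<open>W\<close> inside
  all the unit balls about \<open>A\<close>.\<close>

lemma saturated_common_neighbour:
  assumes sat: "saturated L S E" and S: "S \<subseteq> circle L" and L: "L \<ge> 2"
    and W: "open W" "x \<in> W" "norm x = 1" and A: "finite A" "A \<subseteq> S"
      "\<And>a. a \<in> A \<Longrightarrow> dist x (circle_point L a) < chord L 1"
  shows "\<exists>s\<in>S. circle_point L s \<in> W \<and> (\<forall>a\<in>A. {s, a} \<in> E)"
proof -
  define W' where "W' = W \<inter> (\<Inter>a\<in>A. ball (circle_point L a) (chord L 1))"
  have "open W'" "x \<in> W'" using W A by (auto simp: W'_def dist_commute)
  then have U: "open (circle_point L -` W')" "circle_point L -` W' \<inter> {0<..<L} \<noteq> {}"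
    using circle_point_vimage_meets[of L W' x] L W(3) by auto
  have "\<exists>s\<in>S \<inter> circle_point L -` W'. s \<notin> A \<union> {} \<and> (\<forall>w\<in>A. {s, w} \<in> E) \<and> (\<forall>w\<in>{}. {s, w} \<notin> E)"
  proof (rule saturatedD[OF sat U])
    fix s w assume s: "s \<in> circle_point L -` W' \<inter> circle L" and w: "w \<in> A \<union> {}"
    then have "dist (circle_point L s) (circle_point L w) < chord L 1" by (auto simp: W'_def dist_commute)
    then show "circle_dist L s w < 1"
      using dist_circle_point_less_iff[of s L w] s w A S L by auto
  qed (use A in auto)
  then show ?thesis by (auto simp: W'_def)
qed

section \<open>Irrational circumference\<close>

text \<open>Phrased by adjacency alone, so that isomorphisms preserve it;
  \<open>linked_iff_dist_le\<close> gives its metric meaning.\<close>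

definition linked :: "'v set \<Rightarrow> 'v set set \<Rightarrow> 'v \<Rightarrow> 'v \<Rightarrow> bool" where
  "linked S E z v \<longleftrightarrow>
     (\<forall>A. finite A \<longrightarrow> A \<subseteq> {w \<in> S. {v, w} \<in> E} \<longrightarrow> (\<exists>w\<in>S. \<forall>a\<in>insert z A. {w, a} \<in> E))"

text \<open>If \<open>z\<close> is within 1 of \<open>v\<close>, some point next to \<open>v\<close>
  is close to \<open>z\<close> and to all of \<open>A\<close>, and saturation applies near it.
  Conversely, compactness turns the common neighbours into one point of the circle within 1 of
  \<open>z\<close> and of all neighbours of \<open>v\<close>; only \<open>v\<close> itself is within
  1 of all its neighbours.\<close>

lemma linked_iff_dist_le:
  assumes sat: "saturated L S E" and E: "E \<subseteq> close_pairs L S" and S: "S \<subseteq> circle L" and L: "L > 2"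
    and zv: "z \<in> S" "v \<in> S"
  shows "linked S E z v \<longleftrightarrow> dist (circle_point L z) (circle_point L v) \<le> chord L 1"
proof
  have edge: "dist (circle_point L u) (circle_point L w) < chord L 1" if "{u, w} \<in> E" for u w
  proof -
    have "{u, w} \<in> close_pairs L S" using that E by blast
    then show ?thesis
      using close_pairsD[of u w L S] S L by (subst dist_circle_point_less_iff) auto
  qed
  define N where "N = {w \<in> S. {v, w} \<in> E}"
  {
    assume zv': "dist (circle_point L z) (circle_point L v) \<le> chord L 1"
    show "linked S E z v"
      unfolding linked_def
    proof (intro allI impI)
      fix A assume A: "finite A" "A \<subseteq> {w \<in> S. {v, w} \<in> E}"
      define W where "W = (\<Inter>a\<in>A. ball (circle_point L a) (chord L 1))"
      have "open W" "circle_point L v \<in> W"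
        using A edge by (auto simp: W_def insert_commute)
      then obtain x where x: "x \<in> W" "norm x = 1" "dist x (circle_point L z) < chord L 1"
        using chord_ball_approach[of L "circle_point L z" "circle_point L v" W] zv' L
        by (auto simp: dist_commute)
      have "\<exists>s\<in>S. circle_point L s \<in> UNIV \<and> (\<forall>a\<in>insert z A. {s, a} \<in> E)"
        using A zv x L by (intro saturated_common_neighbour[OF sat S, of _ x]) (auto simp: W_def dist_commute)
      then show "\<exists>w\<in>S. \<forall>a\<in>insert z A. {w, a} \<in> E" by simp
    qed
  next
    assume lk: "linked S E z v"
    \<comment> \<open>Closed balls are taken for the sake of compactness; finitely many of them meet
      on the circle because a common neighbour lies in all of them.\<close>
    define F where "F = (\<lambda>a. cball (circle_point L a) (chord L 1)) ` insert z N"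
    have "sphere 0 1 \<inter> \<Inter>F \<noteq> {}"
    proof (rule compact_imp_fip)
      fix F' assume F': "finite F'" "F' \<subseteq> F"
      obtain A where A: "A \<subseteq> insert z N" "finite A" "F' = (\<lambda>a. cball (circle_point L a) (chord L 1)) ` A"
        using finite_subset_image[OF F'[unfolded F_def]] by blast
      obtain w where "w \<in> S" "\<forall>a\<in>insert z (A \<inter> N). {w, a} \<in> E"
        using lk A(2) unfolding linked_def N_def by (metis (no_types, lifting) Int_lower2 finite_Int)
      then have "circle_point L w \<in> sphere 0 1 \<inter> \<Inter>F'"
        using A edge[of w] by (auto simp: dist_commute intro!: less_imp_le)
      then show "sphere 0 1 \<inter> \<Inter>F' \<noteq> {}" by blast
    qed (auto simp: F_def)
    then obtain x where "x \<in> sphere 0 1" "x \<in> \<Inter>F" by blast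
    then have x: "norm x = 1" "dist (circle_point L z) x \<le> chord L 1"
      "\<And>w. w \<in> N \<Longrightarrow> dist (circle_point L w) x \<le> chord L 1"
      by (simp_all add: F_def)
    have "x = circle_point L v"
    proof (rule ccontr)
      assume "x \<noteq> circle_point L v"
      then obtain y where y: "norm y = 1" "dist y (circle_point L v) < chord L 1" "dist y x > chord L 1"
        using chord_balls_separate[OF L x(1), of "circle_point L v"] by auto
      \<comment> \<open>Near \<open>y\<close> there is a neighbour of \<open>v\<close> that is
        farther than 1 from \<open>x\<close>, against the choice of \<open>x\<close>.\<close>
      have "\<exists>s\<in>S. circle_point L s \<in> {y. dist y x > chord L 1} \<and> (\<forall>a\<in>{v}. {s, a} \<in> E)"
        using y zv L
        by (intro saturated_common_neighbour[OF sat S, of _ y]) (auto intro!: open_Collect_less continuous_intros)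
      then obtain s where "s \<in> S" "dist (circle_point L s) x > chord L 1" "{s, v} \<in> E" by auto
      then show False using x(3)[of s] by (auto simp: N_def insert_commute)
    qed
    then show "dist (circle_point L z) (circle_point L v) \<le> chord L 1" using x(2) by simp
  }
qed

lemma linked_iso:
  assumes f: "bij_betw f S S'" and iso: "\<And>u v. u \<in> S \<Longrightarrow> v \<in> S \<Longrightarrow> {u, v} \<in> E \<longleftrightarrow> {f u, f v} \<in> E'"
    and zv: "z \<in> S" "v \<in> S" and lk: "linked S E z v"
  shows "linked S' E' (f z) (f v)"
  unfolding linked_def
proof (intro allI impI)
  fix A' assume A': "finite A'" "A' \<subseteq> {w \<in> S'. {f v, w} \<in> E'}"
  define A where "A = inv_into S f ` A'"
  have "A' \<subseteq> f ` S" using A'(2) f by (auto simp: bij_betw_def)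
  then have img: "f ` A = A'" and "A \<subseteq> S"
    by (auto simp: A_def image_inv_into_cancel inv_into_into subset_iff)
  have "A \<subseteq> {w \<in> S. {v, w} \<in> E}"
    using img A'(2) \<open>A \<subseteq> S\<close> iso[OF zv(2)] by auto
  then obtain w where w: "w \<in> S" "\<And>a. a \<in> insert z A \<Longrightarrow> {w, a} \<in> E"
    using lk A'(1) unfolding linked_def A_def by (meson finite_imageI)
  have "{f w, a'} \<in> E'" if "a' \<in> insert (f z) A'" for a'
  proof -
    obtain a where "a \<in> insert z A" "a' = f a" using \<open>a' \<in> _\<close> img by auto
    then show ?thesis using w iso[of w a] zv \<open>A \<subseteq> S\<close> by auto
  qed
  moreover have "f w \<in> S'" using f w(1) by (auto simp: bij_betw_def)
  ultimately show "\<exists>w\<in>S'. \<forall>a\<in>insert (f z) A'. {w, a} \<in> E'" by blast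
qed

lemma linked_iso_iff:
  assumes f: "bij_betw f S S'" and iso: "\<And>u v. u \<in> S \<Longrightarrow> v \<in> S \<Longrightarrow> {u, v} \<in> E \<longleftrightarrow> {f u, f v} \<in> E'"
    and zv: "z \<in> S" "v \<in> S"
  shows "linked S E z v \<longleftrightarrow> linked S' E' (f z) (f v)"
proof
  assume "linked S' E' (f z) (f v)"
  moreover have "{u, v} \<in> E' \<longleftrightarrow> {inv_into S f u, inv_into S f v} \<in> E" if "u \<in> S'" "v \<in> S'" for u v
    using that f iso[of "inv_into S f u" "inv_into S f v"]
    by (simp add: bij_betw_def f_inv_into_f inv_into_into)
  moreover have "f z \<in> S'" "f v \<in> S'" using f zv by (auto simp: bij_betw_def)
  ultimately have "linked S E (inv_into S f (f z)) (inv_into S f (f v))"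
    by (intro linked_iso[OF bij_betw_inv_into[OF f]])
  then show "linked S E z v" using f zv by (simp add: bij_betw_def inv_into_f_f)
qed (rule linked_iso[OF assms])

section \<open>Rigidity of bijections preserving distance at most 1\<close>

text \<open>\<open>k\<close> equals \<open>k 0\<close> at all \<open>n * L - h\<close> with integers
  \<open>n\<close> and \<open>h\<close>, and these are dense for irrational
  \<open>L\<close>.\<close>

lemma continuous_two_periods_constant:
  fixes k :: "real \<Rightarrow> 'b::metric_space"
  assumes k: "continuous_on UNIV k" and L: "L \<notin> \<rat>"
    and per: "\<And>t (n::int). k (t + of_int n) = k t" "\<And>t (n::int). k (t + of_int n * L) = k t"
  shows "k t = k 0"
proof (rule ccontr)
  assume "k t \<noteq> k 0"
  then obtain d where d: "d > 0" "\<And>t'. dist t' t < d \<Longrightarrow> dist (k t') (k t) < dist (k 0) (k t)"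
    using k by (metis UNIV_I continuous_on_iff zero_less_dist_iff)
  obtain h n where hn: "\<bar>of_int n * L - of_int h - t\<bar> < d"
    using sequence_of_fractional_parts_is_dense[OF L d(1)] by blast
  have "k (of_int n * L - of_int h) = k 0"
    using per(1)[of "of_int n * L" "- h"] per(2)[of 0 n] by simp
  then show False using d(2)[of "of_int n * L - of_int h"] hn by (simp add: dist_real_def)
qed

lemma closure_circle_point_dense:
  assumes S: "dense_in_circle L S" and L: "L > 0"
  shows "closure (circle_point L ` S) = sphere 0 1"
proof
  have "circle_point L ` S \<subseteq> sphere 0 1" by auto
  then show "closure (circle_point L ` S) \<subseteq> sphere 0 1" by (rule closure_minimal) simp
  show "sphere 0 1 \<subseteq> closure (circle_point L ` S)"
  proof
    fix x :: complex assume x: "x \<in> sphere 0 1"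
    show "x \<in> closure (circle_point L ` S)"
      unfolding closure_approachable
    proof (intro allI impI)
      fix e :: real assume "e > 0"
      then have "S \<inter> circle_point L -` ball x e \<inter> {0<..<L} \<noteq> {}"
        using x L by (intro dense_in_circle_meets_open[OF S] circle_point_vimage_meets[of L _ x]) auto
      then show "\<exists>y\<in>circle_point L ` S. dist y x < e" by (auto simp: dist_commute)
    qed
  qed
qed

text \<open>
  If \<open>u, v\<close> both approach \<open>x\<close> while \<open>f u, f v\<close> approach distinct \<open>y, y'\<close>, then infinitely many
  points of \<open>S'\<close> are closer than \<open>1\<close> to \<open>y\<close> and farther than \<open>1\<close> from \<open>y'\<close>, so their preimages are
  all at distance exactly \<open>1\<close> from \<open>x\<close>.
\<close>

lemma closeness_preserving_uniformly_continuous: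
  assumes L: "L > 2" and S: "S \<subseteq> circle L" and S': "dense_in_circle L S'" and f: "bij_betw f S S'"
    and pres: "\<And>u v. u \<in> S \<Longrightarrow> v \<in> S \<Longrightarrow>
       dist (circle_point L u) (circle_point L v) \<le> chord L 1 \<longleftrightarrow>
       dist (circle_point L (f u)) (circle_point L (f v)) \<le> chord L 1"
  shows "uniformly_continuous_on (circle_point L ` S) (\<lambda>z. circle_point L (f (inv_into S (circle_point L) z)))"
proof (rule ccontr)
  let ?e = "circle_point L" and ?r = "chord L 1"
  have inj: "inj_on ?e S" using inj_on_circle_point[of L] L S by (auto intro: inj_on_subset)
  assume "\<not> ?thesis"
  then have "\<not> (\<forall>\<epsilon>>0. \<exists>d>0. \<forall>v\<in>S. \<forall>u\<in>S. dist (?e u) (?e v) < d \<longrightarrow> dist (?e (f u)) (?e (f v)) < \<epsilon>)"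
    unfolding uniformly_continuous_on_def by (simp add: inj inv_into_f_f)
  then obtain \<epsilon> where \<epsilon>: "\<epsilon> > 0"
    "\<And>d. d > 0 \<Longrightarrow> \<exists>u\<in>S. \<exists>v\<in>S. dist (?e u) (?e v) < d \<and> \<epsilon> \<le> dist (?e (f u)) (?e (f v))"
    by (metis not_less)
  then have "\<exists>u\<in>S. \<exists>v\<in>S. dist (?e u) (?e v) < 1 / Suc n \<and> \<epsilon> \<le> dist (?e (f u)) (?e (f v))" for n
    by simp
  then obtain u v where uv: "\<And>n. u n \<in> S" "\<And>n. v n \<in> S" "\<And>n. dist (?e (u n)) (?e (v n)) < 1 / Suc n"
    "\<And>n. \<epsilon> \<le> dist (?e (f (u n))) (?e (f (v n)))" by metis
  \<comment> \<open>Compactness gives a common subsequence along which the images under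
    \<open>f\<close> converge to \<open>y\<close> and \<open>y'\<close>; the points \<open>u\<close>
    and \<open>v\<close> then share the limit \<open>x\<close>.\<close>
  have "seq_compact (sphere (0::complex) 1 \<times> sphere (0::complex) 1 \<times> sphere (0::complex) 1)"
    unfolding seq_compact_eq_compact by (intro compact_Times compact_sphere)
  then obtain l \<sigma> where \<sigma>: "strict_mono (\<sigma> :: nat \<Rightarrow> nat)"
    "((\<lambda>n. (?e (u n), ?e (f (u n)), ?e (f (v n)))) \<circ> \<sigma>) \<longlonglongrightarrow> l"
    "l \<in> sphere 0 1 \<times> sphere 0 1 \<times> sphere 0 1"
    unfolding seq_compact_def by (smt (verit) SigmaI mem_sphere_0 norm_circle_point)
  obtain x y y' where l: "l = (x, y, y')" by (cases l)
  have xy: "norm y = 1" "norm y' = 1" using \<sigma>(3) l by auto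
  have lim: "(\<lambda>n. ?e (u (\<sigma> n))) \<longlonglongrightarrow> x" "(\<lambda>n. ?e (f (u (\<sigma> n)))) \<longlonglongrightarrow> y" "(\<lambda>n. ?e (f (v (\<sigma> n)))) \<longlonglongrightarrow> y'"
    using tendsto_fst[OF \<sigma>(2)] tendsto_fst[OF tendsto_snd[OF \<sigma>(2)]] tendsto_snd[OF tendsto_snd[OF \<sigma>(2)]]
    by (auto simp: l o_def)
  have "(\<lambda>n. dist (?e (u (\<sigma> n))) (?e (v (\<sigma> n)))) \<longlonglongrightarrow> 0"
  proof (rule tendsto_sandwich[of "\<lambda>_. 0" _ _ "\<lambda>n. 1 / real (Suc (\<sigma> n))"])
    show "(\<lambda>n. 1 / real (Suc (\<sigma> n))) \<longlonglongrightarrow> 0"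
      using LIMSEQ_subseq_LIMSEQ[OF LIMSEQ_Suc[OF lim_1_over_n] \<sigma>(1)] by (simp add: o_def)
  qed (use uv(3) in \<open>auto intro!: always_eventually less_imp_le\<close>)
  then have "(\<lambda>n. ?e (v (\<sigma> n)) - ?e (u (\<sigma> n))) \<longlonglongrightarrow> 0"
    by (subst tendsto_norm_zero_iff[symmetric]) (simp add: dist_norm norm_minus_commute)
  then have lim': "(\<lambda>n. ?e (v (\<sigma> n))) \<longlonglongrightarrow> x"
    by (rule Lim_transform[OF lim(1)])
  have "\<epsilon> \<le> dist y y'"
    by (rule tendsto_lowerbound[OF tendsto_dist[OF lim(2,3)]]) (auto simp: uv(4))
  then have "y' \<noteq> y" using \<epsilon>(1) by auto
  then obtain y0 where y0: "norm y0 = 1" "dist y0 y < ?r" "dist y0 y' > ?r"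
    using chord_balls_separate[OF L xy(2,1)] by blast
  define W where "W = {w. dist w y < ?r} \<inter> {w. dist w y' > ?r}"
  have W: "open W" unfolding W_def by (intro open_Int open_Collect_less continuous_intros)
  define T where "T = {s \<in> S. ?e (f s) \<in> W}"
  have "f ` T = S' \<inter> ?e -` W"
    using f by (auto simp: T_def bij_betw_def)
  moreover have "infinite (S' \<inter> ?e -` W)"
    using y0 L W by (intro dense_in_circle_infinite[OF S'] circle_point_vimage_meets[of L W y0])
      (auto simp: W_def)
  ultimately have inf: "infinite T" by (metis finite_imageI)
  have dist_x: "dist (?e s) x = ?r" if s: "s \<in> T" for s
  proof (rule antisym)
    have "\<forall>\<^sub>F n in sequentially. dist (?e (f s)) (?e (f (u (\<sigma> n)))) < ?r"
      using s by (intro order_tendstoD(2)[OF tendsto_dist[OF tendsto_const lim(2)]]) (auto simp: T_def W_def)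
    then have "\<forall>\<^sub>F n in sequentially. dist (?e s) (?e (u (\<sigma> n))) \<le> ?r"
      by eventually_elim (use s pres uv(1) in \<open>auto simp: T_def\<close>)
    then show "dist (?e s) x \<le> ?r"
      by (intro tendsto_upperbound[OF tendsto_dist[OF tendsto_const lim(1)]]) auto
    have "\<forall>\<^sub>F n in sequentially. ?r < dist (?e (f s)) (?e (f (v (\<sigma> n))))"
      using s by (intro order_tendstoD(1)[OF tendsto_dist[OF tendsto_const lim(3)]]) (auto simp: T_def W_def)
    then have "\<forall>\<^sub>F n in sequentially. ?r \<le> dist (?e s) (?e (v (\<sigma> n)))"
    proof eventually_elim
      case (elim n)
      then show ?case using s pres[of s "v (\<sigma> n)"] uv(2) by (auto simp: T_def)
    qed
    then show "?r \<le> dist (?e s) x"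
      by (intro tendsto_lowerbound[OF tendsto_dist[OF tendsto_const lim']]) auto
  qed
  obtain t where t: "x = ?e t" using ex_circle_point[of L x] L \<sigma>(3) l by auto
  \<comment> \<open>At most two points of the circle lie at distance exactly 1 from
    \<open>x\<close>, against the infinitude of \<open>T\<close>.\<close>
  have "?e ` T \<subseteq> {?e (t + 1), ?e (t - 1)}"
  proof (rule image_subsetI)
    fix s assume "s \<in> T"
    then show "?e s \<in> {?e (t + 1), ?e (t - 1)}"
      using dist_eq_chord_1[of L "?e s" t] dist_x[of s] L t by simp
  qed
  then have "finite (?e ` T)" by (rule finite_subset) simp
  moreover have "inj_on ?e T" using inj by (rule inj_on_subset) (auto simp: T_def)
  ultimately have "finite T" by (rule finite_imageD)
  then show False using inf by simp
qed

text \<open>By uniform continuity the map extends to the closure of the point set, which is the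
  whole circle; \<open>h\<close> is the extension read in the real parameter.\<close>

lemma closeness_preserving_extension:
  assumes L: "L > 2" and S: "dense_in_circle L S" and S': "dense_in_circle L S'" and f: "bij_betw f S S'"
    and pres: "\<And>u v. u \<in> S \<Longrightarrow> v \<in> S \<Longrightarrow>
       dist (circle_point L u) (circle_point L v) \<le> chord L 1 \<longleftrightarrow>
       dist (circle_point L (f u)) (circle_point L (f v)) \<le> chord L 1"
  obtains h where "continuous_on UNIV h" "\<And>t. norm (h t) = 1" "\<And>t n. h (t + of_int n * L) = h t"
    "\<And>t. dist (h (t + 1)) (h t) = chord L 1" "\<And>s. s \<in> S \<Longrightarrow> h s = circle_point L (f s)"
proof -
  let ?e = "circle_point L" and ?r = "chord L 1"
  have Sc: "S \<subseteq> circle L" using S by (simp add: dense_in_circle_def)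
  have inj: "inj_on ?e S" using inj_on_circle_point[of L] L Sc by (auto intro: inj_on_subset)
  have cl: "closure (?e ` S) = sphere 0 1" using closure_circle_point_dense[OF S] L by simp
  define F where "F z = ?e (f (inv_into S ?e z))" for z
  have "uniformly_continuous_on (?e ` S) F"
    unfolding F_def using L Sc S' f pres by (rule closeness_preserving_uniformly_continuous)
  then obtain g where "uniformly_continuous_on (closure (?e ` S)) g" and g': "\<And>z. z \<in> ?e ` S \<Longrightarrow> F z = g z"
    by (rule uniformly_continuous_on_extension_on_closure) (rule that)
  then have g: "continuous_on (sphere 0 1) g"
    using cl uniformly_continuous_imp_continuous by metis
  have gS: "g (?e s) = ?e (f s)" if "s \<in> S" for s
    using g'[of "?e s"] that inj by (simp add: F_def inv_into_f_f)
  have norm_g: "norm (g z) = 1" if "z \<in> sphere 0 1" for z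
    by (rule continuous_constant_on_closure[of "?e ` S" "\<lambda>z. norm (g z)"])
       (use g gS that cl in \<open>auto intro!: continuous_intros\<close>)
  have seq: "\<exists>s. (\<forall>n. s n \<in> S) \<and> (\<lambda>n. ?e (s n)) \<longlonglongrightarrow> z \<and> (\<lambda>n. ?e (f (s n))) \<longlonglongrightarrow> g z"
    if z: "z \<in> sphere 0 1" for z
  proof -
    have "z \<in> closure (?e ` S)" using z cl by simp
    then obtain w where w: "\<And>n. w n \<in> ?e ` S" "w \<longlonglongrightarrow> z"
      unfolding closure_sequential by blast
    then have "\<forall>n. \<exists>s. s \<in> S \<and> w n = ?e s" by blast
    then obtain s where s: "\<And>n. s n \<in> S" "\<And>n. w n = ?e (s n)" by metis
    have "w = (\<lambda>n. ?e (s n))" using s(2) by auto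
    then have lim: "(\<lambda>n. ?e (s n)) \<longlonglongrightarrow> z" using w(2) by simp
    then have "(\<lambda>n. g (?e (s n))) \<longlonglongrightarrow> g z"
      using z by (intro continuous_on_tendsto_compose[OF g lim]) auto
    then show ?thesis using s(1) lim gS by (intro exI[of _ s]) simp
  qed
  \<comment> \<open>A strict inequality between \<open>z\<close> and \<open>w\<close> persists along
    the approximating sequences, where \<open>pres\<close> applies; the limit of the images keeps
    the weak inequality.\<close>
  have le: "dist (g z) (g w) \<le> ?r" if zw: "z \<in> sphere 0 1" "w \<in> sphere 0 1" "dist z w < ?r" for z w
  proof -
    obtain s where s: "\<And>n. s n \<in> S" "(\<lambda>n. ?e (s n)) \<longlonglongrightarrow> z" "(\<lambda>n. ?e (f (s n))) \<longlonglongrightarrow> g z"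
      using seq[OF zw(1)] by blast
    obtain t where t: "\<And>n. t n \<in> S" "(\<lambda>n. ?e (t n)) \<longlonglongrightarrow> w" "(\<lambda>n. ?e (f (t n))) \<longlonglongrightarrow> g w"
      using seq[OF zw(2)] by blast
    have "\<forall>\<^sub>F n in sequentially. dist (?e (s n)) (?e (t n)) < ?r"
      by (rule order_tendstoD(2)[OF tendsto_dist[OF s(2) t(2)] zw(3)])
    then have "\<forall>\<^sub>F n in sequentially. dist (?e (f (s n))) (?e (f (t n))) \<le> ?r"
    proof eventually_elim
      case (elim n)
      then show ?case using pres[OF s(1)[of n] t(1)[of n]] by linarith
    qed
    then show ?thesis
      by (intro tendsto_upperbound[OF tendsto_dist[OF s(3) t(3)]]) auto
  qed
  have ge: "?r \<le> dist (g z) (g w)" if zw: "z \<in> sphere 0 1" "w \<in> sphere 0 1" "?r < dist z w" for z w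
  proof -
    obtain s where s: "\<And>n. s n \<in> S" "(\<lambda>n. ?e (s n)) \<longlonglongrightarrow> z" "(\<lambda>n. ?e (f (s n))) \<longlonglongrightarrow> g z"
      using seq[OF zw(1)] by blast
    obtain t where t: "\<And>n. t n \<in> S" "(\<lambda>n. ?e (t n)) \<longlonglongrightarrow> w" "(\<lambda>n. ?e (f (t n))) \<longlonglongrightarrow> g w"
      using seq[OF zw(2)] by blast
    have "\<forall>\<^sub>F n in sequentially. ?r < dist (?e (s n)) (?e (t n))"
      by (rule order_tendstoD(1)[OF tendsto_dist[OF s(2) t(2)] zw(3)])
    then have "\<forall>\<^sub>F n in sequentially. ?r \<le> dist (?e (f (s n))) (?e (f (t n)))"
    proof eventually_elim
      case (elim n)
      then show ?case using pres[OF s(1)[of n] t(1)[of n]] by linarith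
    qed
    then show ?thesis
      by (intro tendsto_lowerbound[OF tendsto_dist[OF s(3) t(3)]]) auto
  qed
  define h where "h t = g (?e t)" for t
  have h: "continuous_on UNIV h"
    unfolding h_def by (intro continuous_on_compose2[OF g] continuous_intros) auto
  \<comment> \<open>Parameter difference 1 is approached through differences below 1 and through
    differences between 1 and \<open>L - 1\<close>, available since \<open>L > 2\<close>.\<close>
  have "dist (h (t + 1)) (h t) = ?r" for t
  proof (rule antisym)
    have c: "continuous_on A (\<lambda>\<tau>. dist (h (t + \<tau>)) (h t))" for A
      by (intro continuous_intros continuous_on_compose2[OF h]) auto
    have "dist (?e (t + \<tau>)) (?e t) = chord L \<tau>" for \<tau> by (simp add: dist_circle_point)
    note d = this
    show "dist (h (t + 1)) (h t) \<le> ?r"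
    proof (rule continuous_le_on_closure[OF c, of 1 "{0<..<1}"])
      fix \<tau> :: real assume "\<tau> \<in> {0<..<1}"
      then show "dist (h (t + \<tau>)) (h t) \<le> ?r"
        unfolding h_def using L by (intro le) (auto simp: d intro!: chord_less_1)
    qed simp
    show "?r \<le> dist (h (t + 1)) (h t)"
    proof (rule continuous_ge_on_closure[OF c, of 1 "{1<..<L - 1}"])
      fix \<tau> :: real assume "\<tau> \<in> {1<..<L - 1}"
      then show "?r \<le> dist (h (t + \<tau>)) (h t)"
        unfolding h_def using L by (intro ge) (auto simp: d intro!: chord_greater_1)
    qed (use L in simp)
  qed
  moreover have "h (t + of_int n * L) = h t" for t n
    using L circle_point_period_int[of L n] by (simp add: h_def circle_point_add)
  ultimately show ?thesis
    using that[of h] h norm_g gS by (simp add: h_def)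
qed

lemma closeness_preserving_rigid:
  assumes L: "L > 2" "L \<notin> \<rat>" and S: "dense_in_circle L S" and S': "dense_in_circle L S'"
    and f: "bij_betw f S S'"
    and pres: "\<And>u v. u \<in> S \<Longrightarrow> v \<in> S \<Longrightarrow>
       dist (circle_point L u) (circle_point L v) \<le> chord L 1 \<longleftrightarrow>
       dist (circle_point L (f u)) (circle_point L (f v)) \<le> chord L 1"
  shows "\<exists>c. (\<forall>s\<in>S. circle_point L (f s) = c * circle_point L s) \<or>
             (\<forall>s\<in>S. circle_point L (f s) = c * cnj (circle_point L s))"
proof -
  let ?e = "circle_point L" and ?r = "chord L 1"
  obtain h where h: "continuous_on UNIV h" "\<And>t. norm (h t) = 1" "\<And>t n. h (t + of_int n * L) = h t"
    "\<And>t. dist (h (t + 1)) (h t) = ?r" "\<And>s. s \<in> S \<Longrightarrow> h s = ?e (f s)"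
    using closeness_preserving_extension[OF L(1) S S' f pres] by metis
  have h0: "h t \<noteq> 0" for t using h(2)[of t] by auto
  \<comment> \<open>\<open>h (t + 1)\<close> is one of the two points at distance 1 from
    \<open>h t\<close>, so \<open>q\<close> is continuous with at most two values on a connected
    line, hence constant.\<close>
  define q where "q t = h (t + 1) / h t" for t
  have q: "q t \<in> {?e 1, ?e (- 1)}" for t
  proof -
    obtain a where a: "h t = ?e a" using ex_circle_point[of L "h t"] h(2) L by auto
    then have "h (t + 1) = ?e (a + 1) \<or> h (t + 1) = ?e (a - 1)"
      using dist_eq_chord_1[of L "h (t + 1)" a] h(2)[of "t + 1"] h(4)[of t] L(1) by simp
    then show ?thesis
      using circle_point_add[of L a 1] circle_point_add[of L a "- 1"] by (auto simp: q_def a)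
  qed
  have "q constant_on UNIV"
  proof (rule continuous_finite_range_constant)
    show "continuous_on UNIV q"
      unfolding q_def using h0 by (intro continuous_intros continuous_on_compose2[OF h(1)]) auto
    show "finite (range q)" by (rule finite_subset[of _ "{?e 1, ?e (- 1)}"]) (use q in auto)
  qed simp
  then obtain b where b: "\<And>t. q t = b" by (auto simp: constant_on_def)
  have step: "h (t + 1) = b * h t" for t using b[of t] h0[of t] by (simp add: q_def field_simps)
  have const: "\<exists>c. \<forall>t. h t = c * ?e (\<delta> * t)" if \<delta>: "\<delta> \<in> {1, - 1}" "b = ?e \<delta>" for \<delta> :: real
  proof -
    \<comment> \<open>Undoing the rotation (\<delta> = 1) or the reflection (\<delta> = - 1) leaves
      a function with periods 1 and \<open>L\<close>.\<close>
    define k where "k t = h t * ?e (- \<delta> * t)" for t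
    have "k t = k 0" for t
    proof (rule continuous_two_periods_constant[OF _ L(2)])
      show "continuous_on UNIV k"
        unfolding k_def by (intro continuous_intros continuous_on_compose2[OF h(1)]) auto
      have k1: "k (t + 1) = k t" for t
      proof -
        have "- \<delta> * (t + 1) = - \<delta> + - \<delta> * t" by (simp add: algebra_simps)
        then have "k (t + 1) = ?e \<delta> * ?e (- \<delta>) * (h t * ?e (- \<delta> * t))"
          using step[of t] \<delta>(2) by (simp only: k_def circle_point_add mult_ac)
        also have "?e \<delta> * ?e (- \<delta>) = 1" by (simp flip: circle_point_add)
        finally show ?thesis by (simp only: k_def mult_1)
      qed
      have kn: "k (t + real n) = k t" for t and n :: nat
      proof (induction n)
        case (Suc n)
        then show ?case using k1[of "t + real n"] by (simp add: add_ac)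
      qed simp
      show "k (t + of_int n) = k t" for t and n :: int
        using kn[of t "nat n"] kn[of "t + of_int n" "nat (- n)"] by (cases "n \<ge> 0") auto
      show "k (t + of_int n * L) = k t" for t and n :: int
      proof -
        have "- \<delta> * (t + of_int n * L) = - \<delta> * t + - \<delta> * (of_int n * L)" by (simp add: ring_distribs)
        moreover have "?e (- \<delta> * (of_int n * L)) = 1"
          using \<delta>(1) L(1) circle_point_period_int[of L n] circle_point_period_int[of L "- n"] by auto
        ultimately show ?thesis
          using h(3)[of t n] by (simp only: k_def circle_point_add mult_1_right)
      qed
    qed
    moreover have "k t * ?e (\<delta> * t) = h t" for t
      by (simp add: k_def mult.assoc flip: circle_point_add)
    ultimately have "h t = k 0 * ?e (\<delta> * t)" for t by metis
    then show ?thesis by blast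
  qed
  show ?thesis
  proof (cases "b = ?e 1")
    case True
    then obtain c where "\<And>t. h t = c * ?e t" using const[of 1] by auto
    then have "\<forall>s\<in>S. ?e (f s) = c * ?e s" using h(5) by metis
    then show ?thesis by blast
  next
    case False
    then have "b = ?e (- 1)" using q[of 0] b[of 0] by auto
    then obtain c where "\<And>t. h t = c * ?e (- t)" using const[of "- 1"] by auto
    then have "\<forall>s\<in>S. ?e (f s) = c * cnj (?e s)" using h(5) by (metis circle_point_minus)
    then show ?thesis by blast
  qed
qed

section \<open>Independent graphs are not matched by a fixed map\<close>

lemma edge_set_space_Collect:
  "finite J \<Longrightarrow> {E \<in> space (edge_set_space L S). \<forall>e\<in>J. \<psi> e \<in> E \<longleftrightarrow> e \<in> K} \<in> sets (edge_set_space L S)"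
proof (intro sets.sets_Collect_finite_All)
  fix e assume "finite J" "e \<in> J"
  have gen: "(\<lambda>e. {E \<in> Pow (close_pairs L S). e \<in> E}) ` close_pairs L S \<subseteq> Pow (Pow (close_pairs L S))" by auto
  have "{E \<in> Pow (close_pairs L S). \<psi> e \<in> E} \<in> sets (edge_set_space L S)"
  \<comment> \<open>The image of a pair may fall outside the close pairs; its event is then
    empty.\<close>
  proof (cases "\<psi> e \<in> close_pairs L S")
    case True
    then show ?thesis
      unfolding edge_set_space_def sets_measure_of[OF gen] by (intro sigma_sets.Basic imageI)
  next
    case False
    then have "{E \<in> Pow (close_pairs L S). \<psi> e \<in> E} = {}" by blast
    then show ?thesis by (simp only: sets.empty_sets)
  qed
  moreover have "space (edge_set_space L S) = Pow (close_pairs L S)"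
    unfolding edge_set_space_def using gen by (rule space_measure_of)
  ultimately have *: "{E \<in> space (edge_set_space L S). \<psi> e \<in> E} \<in> sets (edge_set_space L S)" by simp
  show "{E \<in> space (edge_set_space L S). \<psi> e \<in> E \<longleftrightarrow> e \<in> K} \<in> sets (edge_set_space L S)"
    using * sets.sets_Collect_neg[OF *] by (cases "e \<in> K") simp_all
qed

text \<open>Whatever pattern \<open>G'\<close> shows on the images of \<open>n\<close> pairs,
  \<open>G\<close> matches it with probability at most \<open>q ^ n\<close>; independence allows
  averaging over the patterns. Letting \<open>n\<close> grow leaves probability 0.\<close>

lemma (in prob_space) AE_independent_graphs_differ:
  assumes G: "random_geometric_graph M L S p G" and p: "0 < p" "p < 1"
    and ind: "indep_var (edge_set_space L S) G (edge_set_space L S') G'"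
    and I: "infinite I" "I \<subseteq> close_pairs L S"
  shows "AE \<omega> in M. \<exists>e\<in>I. (e \<in> G \<omega>) \<noteq> (\<psi> e \<in> G' \<omega>)"
proof -
  \<comment> \<open>Bounds the probability that a single pair of \<open>G\<close> is in a prescribed
    state.\<close>
  define q where "q = max p (1 - p)"
  have q: "0 < q" "q < 1" using p by (auto simp: q_def)
  have meas: "G \<in> measurable M (edge_set_space L S)" "G' \<in> measurable M (edge_set_space L S')"
    using ind by (auto simp: indep_var_eq)
  define X where "X J K = {\<omega> \<in> space M. \<forall>e\<in>J. e \<in> G \<omega> \<longleftrightarrow> e \<in> K}" for J K
  define Y where "Y J K = {\<omega> \<in> space M. \<forall>e\<in>J. \<psi> e \<in> G' \<omega> \<longleftrightarrow> e \<in> K}" for J K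
  have X: "X J K = G -` {E \<in> space (edge_set_space L S). \<forall>e\<in>J. e \<in> E \<longleftrightarrow> e \<in> K} \<inter> space M" for J K
    using measurable_space[OF meas(1)] by (auto simp: X_def)
  have Y: "Y J K = G' -` {E \<in> space (edge_set_space L S'). \<forall>e\<in>J. \<psi> e \<in> E \<longleftrightarrow> e \<in> K} \<inter> space M" for J K
    using measurable_space[OF meas(2)] by (auto simp: Y_def)
  have XY: "X J K \<in> events" "Y J K \<in> events" "prob (X J K \<inter> Y J K) = prob (X J K) * prob (Y J K)"
    if J: "finite J" for J K
  proof -
    note mx = edge_set_space_Collect[OF J, of L S "\<lambda>e. e" K]
    note my = edge_set_space_Collect[OF J, of L S' \<psi> K]
    show "X J K \<in> events" unfolding X by (rule measurable_sets[OF meas(1) mx])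
    show "Y J K \<in> events" unfolding Y by (rule measurable_sets[OF meas(2) my])
    have "X J K \<inter> Y J K = (\<lambda>\<omega>. (G \<omega>, G' \<omega>)) -`
        ({E \<in> space (edge_set_space L S). \<forall>e\<in>J. e \<in> E \<longleftrightarrow> e \<in> K} \<times>
         {E \<in> space (edge_set_space L S'). \<forall>e\<in>J. \<psi> e \<in> E \<longleftrightarrow> e \<in> K}) \<inter> space M"
      unfolding X Y by auto
    then show "prob (X J K \<inter> Y J K) = prob (X J K) * prob (Y J K)"
      using indep_varD[OF ind mx my] X Y by simp
  qed
  have Xle: "prob (X J K) \<le> q ^ card J" if J: "finite J" "J \<subseteq> I" for J K
  proof -
    have "prob {\<omega> \<in> space M. \<forall>e\<in>J. \<omega> \<in> {\<omega> \<in> space M. e \<in> G \<omega>} \<longleftrightarrow> e \<in> K} =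
        (\<Prod>e\<in>J. if e \<in> K then p else 1 - p)"
      using G I J by (intro prob_indep_events_pattern[where I = "close_pairs L S"])
        (auto simp: random_geometric_graph_def)
    also have "{\<omega> \<in> space M. \<forall>e\<in>J. \<omega> \<in> {\<omega> \<in> space M. e \<in> G \<omega>} \<longleftrightarrow> e \<in> K} = X J K"
      by (auto simp: X_def)
    also have "(\<Prod>e\<in>J. if e \<in> K then p else 1 - p) \<le> (\<Prod>e\<in>J. q)"
      using p by (intro prod_mono) (auto simp: q_def)
    finally show ?thesis by simp
  qed
  \<comment> \<open>Agreement on \<open>J\<close> is split by the common pattern \<open>K\<close>;
    the events \<open>Y J K\<close> are disjoint, so their probabilities sum to at most 1.\<close>
  define Z where "Z J = {\<omega> \<in> space M. \<forall>e\<in>J. e \<in> G \<omega> \<longleftrightarrow> \<psi> e \<in> G' \<omega>}" for J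
  have Z: "Z J = (\<Union>K\<in>Pow J. X J K \<inter> Y J K)" if "finite J" for J
  proof (intro equalityI subsetI)
    fix \<omega> assume "\<omega> \<in> Z J"
    then have "\<omega> \<in> X J {e \<in> J. e \<in> G \<omega>} \<inter> Y J {e \<in> J. e \<in> G \<omega>}" by (simp add: X_def Y_def Z_def)
    then show "\<omega> \<in> (\<Union>K\<in>Pow J. X J K \<inter> Y J K)"
      by (intro UN_I[of "{e \<in> J. e \<in> G \<omega>}"]) auto
  qed (auto simp: X_def Y_def Z_def)
  have disjY: "disjoint_family_on (Y J) (Pow J)" for J
  proof (unfold disjoint_family_on_def, intro ballI impI equals0I)
    fix K K' \<omega> assume K: "K \<in> Pow J" "K' \<in> Pow J" "K \<noteq> K'" and \<omega>: "\<omega> \<in> Y J K \<inter> Y J K'"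
    have "\<psi> e \<in> G' \<omega> \<longleftrightarrow> e \<in> K" "\<psi> e \<in> G' \<omega> \<longleftrightarrow> e \<in> K'" if "e \<in> J" for e
      using that \<omega> unfolding Y_def by blast+
    then show False using K by blast
  qed
  have Zle: "prob (Z J) \<le> q ^ card J" if J: "finite J" "J \<subseteq> I" for J
  proof -
    have "prob (Z J) \<le> (\<Sum>K\<in>Pow J. prob (X J K \<inter> Y J K))"
      unfolding Z[OF J(1)] using J XY by (intro finite_measure_subadditive_finite) auto
    also have "\<dots> \<le> (\<Sum>K\<in>Pow J. q ^ card J * prob (Y J K))"
      using J XY Xle by (intro sum_mono) (simp add: mult_right_mono)
    also have "\<dots> = q ^ card J * prob (\<Union>K\<in>Pow J. Y J K)"
      unfolding sum_distrib_left[symmetric] using J XY disjY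
      by (subst finite_measure_finite_Union) auto
    also have "\<dots> \<le> q ^ card J * 1" using q by (intro mult_left_mono) auto
    finally show ?thesis by simp
  qed
  obtain t :: "nat \<Rightarrow> _" where t: "inj t" "range t \<subseteq> I"
    using infinite_countable_subset[OF I(1)] by blast
  have Zev: "Z J \<in> events" if "finite J" for J
    unfolding Z[OF that] using XY that by auto
  \<comment> \<open>Agreement along a sequence of distinct pairs is a measurable event and contains
    agreement on all of \<open>I\<close>.\<close>
  let ?N = "\<Inter>n. Z (t ` {..n})"
  have N: "?N \<in> events" using Zev by (intro sets.countable_INT) auto
  have "prob ?N \<le> q ^ Suc n" for n
  proof -
    have "prob ?N \<le> prob (Z (t ` {..n}))" using Zev by (intro finite_measure_mono) auto
    also have "\<dots> \<le> q ^ card (t ` {..n})" using t by (intro Zle) auto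
    also have "card (t ` {..n}) = Suc n" using t by (subst card_image) (auto intro: inj_on_subset)
    finally show ?thesis .
  qed
  moreover have "(\<lambda>n. q ^ Suc n) \<longlonglongrightarrow> 0"
    using q by (intro LIMSEQ_Suc LIMSEQ_power_zero) auto
  ultimately have "prob ?N \<le> 0" by (intro LIMSEQ_le_const) auto
  then have "?N \<in> null_sets M"
    using N by (auto simp: emeasure_eq_measure null_sets_def measure_nonneg intro: antisym)
  moreover have "{\<omega> \<in> space M. \<not> (\<exists>e\<in>I. (e \<in> G \<omega>) \<noteq> (\<psi> e \<in> G' \<omega>))} \<subseteq> ?N"
    using t by (auto simp: Z_def)
  ultimately show ?thesis by (rule AE_I')
qed

section \<open>Isomorphisms as rotations and reflections\<close>

lemma eq_inv_into_circle_point: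
  assumes "L > 0" "S' \<subseteq> circle L" "s \<in> S'" "circle_point L s = z"
  shows "s = inv_into (circle L) (circle_point L) z"
  using inv_into_f_f[OF inj_on_circle_point[OF assms(1)], of s] assms by auto

lemma infinite_close_pairs:
  assumes "dense_in_circle L S" "L > 0"
  shows "infinite (close_pairs L S)"
proof -
  \<comment> \<open>Points of this interval are pairwise closer than 1, so a star inside it already
    yields infinitely many pairs.\<close>
  define T where "T = S \<inter> {0<..<1}"
  have T: "infinite T"
    unfolding T_def using assms
    by (intro dense_in_circle_infinite) (auto simp: Int_greaterThanLessThan max_def min_def)
  then obtain s where s: "s \<in> T" by (metis all_not_in_conv finite.emptyI)
  have "inj_on (\<lambda>t. {s, t}) (T - {s})" by (auto simp: inj_on_def doubleton_eq_iff)
  moreover have "infinite (T - {s})" using T by simp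
  ultimately have "infinite ((\<lambda>t. {s, t}) ` (T - {s}))" using finite_imageD by blast
  moreover have "circle_dist L s t < 1" if "t \<in> T" for t
    using s that by (auto simp: T_def circle_dist_def)
  then have "(\<lambda>t. {s, t}) ` (T - {s}) \<subseteq> close_pairs L S"
    using s unfolding close_pairs_def by (auto simp: T_def) blast
  ultimately show ?thesis using finite_subset by blast
qed

text \<open>The rotation or reflection of the circle that maps the first point to the second.\<close>

definition circle_motion :: "real \<Rightarrow> bool \<Rightarrow> real \<Rightarrow> real \<Rightarrow> real \<Rightarrow> real" where
  "circle_motion L b s0 s1 s = inv_into (circle L) (circle_point L)
     (if b then circle_point L s1 * cnj (circle_point L s0) * circle_point L s
      else circle_point L s1 * circle_point L s0 * cnj (circle_point L s))"

text \<open>\<open>linked\<close> carries distance at most 1 through the isomorphism, so rigidity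
  applies; the remaining constant is fixed by the image of the base point \<open>s0\<close>.\<close>

lemma saturated_iso_circle_motion:
  assumes L: "L > 2" "L \<notin> \<rat>" and S: "dense_in_circle L S" and S': "dense_in_circle L S'"
    and E: "saturated L S E" "E \<subseteq> close_pairs L S" and E': "saturated L S' E'" "E' \<subseteq> close_pairs L S'"
    and f: "bij_betw f S S'" and iso: "\<And>u v. u \<in> S \<Longrightarrow> v \<in> S \<Longrightarrow> {u, v} \<in> E \<longleftrightarrow> {f u, f v} \<in> E'"
    and s0: "s0 \<in> S"
  shows "\<exists>b. \<forall>s\<in>S. f s = circle_motion L b s0 (f s0) s"
proof -
  have Sc: "S \<subseteq> circle L" "S' \<subseteq> circle L" using S S' by (auto simp: dense_in_circle_def)
  have fS: "f s \<in> S'" if "s \<in> S" for s using f that by (auto simp: bij_betw_def)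
  have norm1: "circle_point L t * cnj (circle_point L t) = 1" for t
    by (simp add: complex_norm_square[symmetric])
  have "dist (circle_point L u) (circle_point L v) \<le> chord L 1 \<longleftrightarrow>
      dist (circle_point L (f u)) (circle_point L (f v)) \<le> chord L 1" if "u \<in> S" "v \<in> S" for u v
    using linked_iff_dist_le[OF E Sc(1) L(1) that] linked_iff_dist_le[OF E' Sc(2) L(1) fS[OF that(1)] fS[OF that(2)]]
      linked_iso_iff[OF f iso that] by blast
  then obtain c where c: "(\<forall>s\<in>S. circle_point L (f s) = c * circle_point L s) \<or>
      (\<forall>s\<in>S. circle_point L (f s) = c * cnj (circle_point L s))"
    using closeness_preserving_rigid[OF L S S' f] by blast
  have inv: "f s = inv_into (circle L) (circle_point L) z" if "s \<in> S" "circle_point L (f s) = z" for s z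
    using eq_inv_into_circle_point[OF _ Sc(2) fS[OF that(1)] that(2)] L by simp
  from c show ?thesis
  proof
    assume *: "\<forall>s\<in>S. circle_point L (f s) = c * circle_point L s"
    \<comment> \<open>Evaluate at \<open>s0\<close>; the inverse of a number of modulus 1 is its
      conjugate.\<close>
    then have "c = circle_point L (f s0) * cnj (circle_point L s0)"
      using s0 norm1[of s0] by (simp add: mult.assoc)
    then show ?thesis
      using * inv by (intro exI[of _ True]) (auto simp: circle_motion_def)
  next
    assume *: "\<forall>s\<in>S. circle_point L (f s) = c * cnj (circle_point L s)"
    then have "c = circle_point L (f s0) * circle_point L s0"
      using s0 norm1[of s0] by (simp add: mult.assoc mult.commute[of "cnj _"])
    then show ?thesis
      using * inv by (intro exI[of _ False]) (auto simp: circle_motion_def)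
  qed
qed

theorem theorem1p2:
  fixes M :: "'a measure" and L p p' :: real and S S' :: "real set"
    and G G' :: "'a \<Rightarrow> real set set"
  assumes "prob_space M"
    and "L \<ge> 2"
    and "countable S" and "dense_in_circle L S"
    and "countable S'" and "dense_in_circle L S'"
    and "0 < p" and "p < 1" and "0 < p'" and "p' < 1"
    and "random_geometric_graph M L S p G"
    and "random_geometric_graph M L S' p' G'"
    and "prob_space.indep_var M (edge_set_space L S) G (edge_set_space L S') G'"
  shows "(L \<notin> \<rat> \<longrightarrow> (AE \<omega> in M. \<not> (S, G \<omega>) \<cong>\<^sub>G (S', G' \<omega>))) \<and>
         (L \<in> \<rat> \<and> integer_distance_free L S \<and> integer_distance_free L S' \<longrightarrow>
            (AE \<omega> in M. (S, G \<omega>) \<cong>\<^sub>G (S', G' \<omega>)))"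
proof -
  interpret prob_space M by fact
  have Sc: "S \<subseteq> circle L" "S' \<subseteq> circle L"
    using assms(4,6) by (auto simp: dense_in_circle_def)
  have sat: "AE \<omega> in M. saturated L S (G \<omega>)" "AE \<omega> in M. saturated L S' (G' \<omega>)"
    using AE_saturated[OF assms(11,7,8,3,4)] AE_saturated[OF assms(12,9,10,5,6)] by auto
  have sub: "G \<omega> \<subseteq> close_pairs L S" "G' \<omega> \<subseteq> close_pairs L S'" if "\<omega> \<in> space M" for \<omega>
    using assms(11,12) that by (auto simp: random_geometric_graph_def)
  have "AE \<omega> in M. \<not> (S, G \<omega>) \<cong>\<^sub>G (S', G' \<omega>)" if irr: "L \<notin> \<rat>"
  proof -
    \<comment> \<open>Separating points by unit balls requires \<open>L > 2\<close>.\<close>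
    have "L \<noteq> 2" using irr Rats_number_of[of "num.Bit0 num.One"] by metis
    then have L: "L > 2" using assms(2) by simp
    obtain s0 where s0: "s0 \<in> S"
      using dense_in_circle_meets_open[OF assms(4), of UNIV] L by auto
    \<comment> \<open>One null set serves all candidates: \<open>b\<close> and the image
      \<open>s1\<close> of the base point range over a countable set, and each motion almost surely
      fails on some pair.\<close>
    have "AE \<omega> in M. \<forall>(b, s1)\<in>UNIV \<times> S'. \<exists>e\<in>close_pairs L S.
        (e \<in> G \<omega>) \<noteq> (circle_motion L b s0 s1 ` e \<in> G' \<omega>)"
    proof (subst AE_ball_countable)
      show "countable (UNIV \<times> S' :: (bool \<times> real) set)" using assms(5) by simp
      show "\<forall>x\<in>UNIV \<times> S'. AE \<omega> in M. case x of (b, s1) \<Rightarrow> \<exists>e\<in>close_pairs L S.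
          (e \<in> G \<omega>) \<noteq> (circle_motion L b s0 s1 ` e \<in> G' \<omega>)"
        using AE_independent_graphs_differ[OF assms(11,7,8,13) infinite_close_pairs[OF assms(4)]] L by auto
    qed
    then show ?thesis
      using sat AE_space
    proof eventually_elim
      case (elim \<omega>)
      show ?case
      proof
        assume "(S, G \<omega>) \<cong>\<^sub>G (S', G' \<omega>)"
        then obtain f where f: "bij_betw f S S'"
          and iso: "\<And>u v. u \<in> S \<Longrightarrow> v \<in> S \<Longrightarrow> {u, v} \<in> G \<omega> \<longleftrightarrow> {f u, f v} \<in> G' \<omega>"
          unfolding graph_iso_def by auto
        \<comment> \<open>Any isomorphism agrees on \<open>S\<close> with one of these
          candidates.\<close>
        obtain b where b: "\<And>s. s \<in> S \<Longrightarrow> f s = circle_motion L b s0 (f s0) s"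
          using saturated_iso_circle_motion[OF L irr assms(4,6) elim(2) sub(1)[OF elim(4)] elim(3)
              sub(2)[OF elim(4)] f iso s0] by blast
        have "f s0 \<in> S'" using f s0 by (auto simp: bij_betw_def)
        then obtain e where e: "e \<in> close_pairs L S"
          "(e \<in> G \<omega>) \<noteq> (circle_motion L b s0 (f s0) ` e \<in> G' \<omega>)" using elim(1) by auto
        then obtain u v where uv: "e = {u, v}" "u \<in> S" "v \<in> S" by (auto simp: close_pairs_def)
        then have "circle_motion L b s0 (f s0) ` e = {f u, f v}" using b by simp
        then show False using e(2) iso uv by simp
      qed
    qed
  qed
  \<comment> \<open>Once both graphs are saturated, the rational case is deterministic.\<close>
  moreover have "AE \<omega> in M. (S, G \<omega>) \<cong>\<^sub>G (S', G' \<omega>)"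
    if "integer_distance_free L S" "integer_distance_free L S'"
    using sat AE_space
  proof eventually_elim
    case (elim \<omega>)
    show ?case
      using assms(2,3,5) that Sc sub[OF elim(3)] elim(1,2) by (intro saturated_graph_iso_rational) auto
  qed
  ultimately show ?thesis by blast
qed

end
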